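(* Let $N$ be any natural number and $\mathrm{Re} (x)>0$. Then \begin{align*} \mathfrak{F}_{0,N}(x)=\frac{x^{-1/N}}{N}\sum_{\substack{j=-(N-1)\\ j\equiv N-1 \ (\mathrm{mod}\ 2)}}^{N-1}e^{-\frac{i\pi j}{N}}\mathfrak{F}_{\frac{N-1}{N},\frac{1}{N}}\left(\frac{e^{-\frac{i\pi j}{N}}}{x^{1/N}}\right)-\frac{1}{2}\left(\log\left(\frac{(2\pi)^N}{x}\right)-\gamma\right)+R(N,x), \end{align*} where \begin{align*} R(N,x):= \begin{cases} \frac{1}{2x}\left(\log(2\pi x)-\gamma\right), &\mathrm{if} \ N=1\\ -\frac{\pi x^{-1/N}\zeta\left(1-1/N\right)}{N\sin(\pi/N)}-\frac{1}{2x}\zeta(N), &\mathrm{if} \ N>1. \end{cases} \end{align*}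
   Context: For $x\in\mathbb{C}\backslash(-\infty,0]$ and real $k,N$ with $k+2N>1$, the extended higher Herglotz function is $\mathfrak{F}_{k,N}(x):=\sum_{n=1}^\infty\frac{1}{n^k}\left(\psi\left(n^Nx\right)-\log\left(n^Nx\right)+\frac{1}{2n^Nx}\right)$, where $\psi=\Gamma'/\Gamma$ is the digamma function. $\gamma$ is Euler's constant and $\zeta$ the Riemann zeta function. The sum over $j$ runs over $j=-(N-1),-(N-3),\dots,N-3,N-1$ (step 2). *)

theory Defs
  imports "HOL-Complex_Analysis.Complex_Analysis"
begin

definition zeta_continuation :: "(complex \<Rightarrow> complex) \<Rightarrow> bool" where
  "zeta_continuation f \<longleftrightarrow>
     f holomorphic_on (- {1}) \<and>
     (\<forall>s. Re s > 1 \<longrightarrow> (\<lambda>n. 1 / of_nat (Suc n) powr s) sums f s)"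

text \<open>
  Existence of the continuation: summing over \<open>n\<close> the binomial expansion of
  \<open>(n + 1)\<^bsup>1-s\<^esup>\<close> about \<open>n\<close>, with the remainder after \<open>K\<close> terms, expresses
  \<open>(s - 1) \<zeta>(s)\<close> through the functions \<open>(u - 1) \<zeta>(u)\<close> at \<open>u = s + 1, \<dots>, s + K - 1\<close> and a
  remainder series that converges for \<open>Re s > 1 - K\<close>.
\<close>

definition zeta_term :: "nat \<Rightarrow> nat \<Rightarrow> complex \<Rightarrow> complex" where
  "zeta_term K n s = of_nat (Suc (Suc n)) powr (1 - s)
     - (\<Sum>k\<le>K. ((1 - s) gchoose k) * of_nat (Suc n) powr (1 - s - of_nat k))"

lemma zeta_term_holomorphic: "zeta_term K n holomorphic_on A"
  unfolding zeta_term_def gbinomial_prod_rev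
  by (intro holomorphic_intros) (auto simp del: of_nat_Suc)

lemma binomial_remainder_bound:
  fixes w :: complex and t :: real
  assumes t: "0 \<le> t" "t \<le> 1"
  shows "norm ((1 + of_real t) powr w - (\<Sum>k\<le>K. (w gchoose k) * of_real t ^ k))
           \<le> (of_nat (Suc K) * norm (w gchoose Suc K) * 2 powr norm w) * t ^ Suc K"
proof -
  define f where "f = (\<lambda>i z. fact i * (w gchoose i) * (1 + z) powr (w - of_nat i) :: complex)"
  define S where "S = closed_segment (0::complex) 1"
  have S: "\<exists>x. z = of_real x \<and> 0 \<le> x \<and> x \<le> 1" if "z \<in> S" for z
    using that by (auto simp: S_def closed_segment_def scaleR_conv_of_real)
  have "norm (f 0 (of_real t) - (\<Sum>i\<le>K. f i 0 * (of_real t - 0) ^ i / fact i))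
          \<le> (fact (Suc K) * norm (w gchoose Suc K) * 2 powr norm w) * norm (of_real t - 0 :: complex) ^ Suc K / fact K"
  proof (rule complex_Taylor)
    show "convex S" by (simp add: S_def)
    show "0 \<in> S" by (simp add: S_def)
    show "of_real t \<in> S"
      using t by (auto simp: S_def closed_segment_def scaleR_conv_of_real intro!: exI[of _ t])
  next
    fix i z assume "z \<in> S"
    then obtain x where x: "z = of_real x" "0 \<le> x" "x \<le> 1" using S by blast
    have nz: "1 + z \<notin> \<real>\<^sub>\<le>\<^sub>0" using x by (auto simp: complex_nonpos_Reals_iff)
    have "(w gchoose Suc i) * of_nat (Suc i) = (w gchoose i) * (w - of_nat i)"
      using gbinomial_mult_1[of w i] by (simp add: algebra_simps)
    hence "fact (Suc i) * (w gchoose Suc i) = fact i * (w gchoose i) * (w - of_nat i)"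
      by (simp add: mult_ac)
    hence eq: "f (Suc i) z = fact i * (w gchoose i) * ((w - of_nat i) * (1 + z) powr (w - of_nat i - 1))"
      by (simp add: f_def diff_diff_eq add.commute mult.assoc del: fact_Suc)
    show "(f i has_field_derivative f (Suc i) z) (at z within S)"
      unfolding eq unfolding f_def using nz
      by (auto intro!: derivative_eq_intros)
  next
    fix z assume "z \<in> S"
    then obtain x where x: "z = of_real x" "0 \<le> x" "x \<le> 1" using S by blast
    have "norm ((1 + z) powr (w - of_nat (Suc K))) = (1 + x) powr (Re w - real (Suc K))"
      using x by (simp add: norm_powr_real_powr)
    also have "\<dots> \<le> (1 + x) powr norm w"
      using x complex_Re_le_cmod[of w] by (intro powr_mono) auto
    also have "\<dots> \<le> 2 powr norm w"
      using x by (intro powr_mono2) auto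
    finally show "norm (f (Suc K) z) \<le> fact (Suc K) * norm (w gchoose Suc K) * 2 powr norm w"
      unfolding f_def by (simp add: norm_mult mult_left_mono del: fact_Suc)
  qed
  moreover have "(fact (Suc K) * norm (w gchoose Suc K) * 2 powr norm w) * norm (of_real t - 0 :: complex) ^ Suc K / fact K
     = (of_nat (Suc K) * norm (w gchoose Suc K) * 2 powr norm w) * t ^ Suc K"
    using t by (simp add: field_simps)
  moreover have "(\<Sum>i\<le>K. f i 0 * (of_real t - 0) ^ i / fact i) = (\<Sum>k\<le>K. (w gchoose k) * of_real t ^ k)"
    by (intro sum.cong) (auto simp: f_def)
  ultimately have "norm (f 0 (of_real t) - (\<Sum>k\<le>K. (w gchoose k) * of_real t ^ k))
      \<le> (of_nat (Suc K) * norm (w gchoose Suc K) * 2 powr norm w) * t ^ Suc K"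
    by (simp only:)
  thus ?thesis by (simp add: f_def)
qed

lemma zeta_term_bound:
  "norm (zeta_term K n s) \<le>
     (of_nat (Suc K) * norm ((1 - s) gchoose Suc K) * 2 powr norm (1 - s)) * real (Suc n) powr (- Re s - real K)"
proof -
  define N where "N = Suc n"
  have N: "N > 0" by (simp add: N_def)
  define w where "w = 1 - s"
  define C where "C = of_nat (Suc K) * norm (w gchoose Suc K) * 2 powr norm w"
  define t where "t = 1 / real N"
  have t: "0 \<le> t" "t \<le> 1" using N by (auto simp: t_def)
  have "of_nat (Suc N) = of_nat N * (1 + complex_of_real t)"
    using N by (simp add: t_def field_simps)
  hence 1: "of_nat (Suc N) powr w = of_nat N powr w * (1 + complex_of_real t) powr w"
    using t by (simp add: powr_times_real del: of_nat_Suc)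
  have 2: "of_nat N powr (w - of_nat k) = of_nat N powr w * complex_of_real t ^ k" for k
    using N by (simp add: t_def powr_diff powr_nat power_divide)
  have "zeta_term K n s = of_nat N powr w *
          ((1 + complex_of_real t) powr w - (\<Sum>k\<le>K. (w gchoose k) * complex_of_real t ^ k))"
    unfolding zeta_term_def N_def[symmetric] w_def[symmetric] 1 2
    by (simp add: right_diff_distrib sum_distrib_left mult_ac)
  also have "norm \<dots> \<le> real N powr Re w * (C * t ^ Suc K)"
    unfolding norm_mult C_def
    by (intro mult_mono binomial_remainder_bound t) (use N in \<open>auto simp: norm_powr_real_powr\<close>)
  also have "t ^ Suc K = real N powr (- real (Suc K))"
    using N powr_realpow[of "real N" "Suc K"]
    by (simp add: t_def powr_minus power_one_over inverse_eq_divide del: of_nat_Suc power_Suc)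
  also have "real N powr Re w * (C * real N powr (- real (Suc K))) = C * real N powr (- Re s - real K)"
    by (simp add: w_def powr_add[symmetric] mult.left_commute)
  finally show ?thesis by (simp add: C_def w_def N_def)
qed

lemma zeta_term_suminf_holomorphic:
  "(\<lambda>s. \<Sum>n. zeta_term K n s) holomorphic_on {s. Re s > 1 - real K}"
proof (rule holomorphic_uniform_sequence[where f = "\<lambda>m s. \<Sum>n<m. zeta_term K n s"])
  show "open {s. Re s > 1 - real K}" by (rule open_halfspace_Re_gt)
  show "(\<lambda>s. \<Sum>n<m. zeta_term K n s) holomorphic_on {s. Re s > 1 - real K}" for m
    by (intro holomorphic_on_sum zeta_term_holomorphic)
next
  fix s assume "s \<in> {s. Re s > 1 - real K}"
  define d where "d = (Re s - (1 - real K)) / 2"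
  have d: "d > 0" using \<open>s \<in> _\<close> by (simp add: d_def)
  have Re: "Re z \<ge> Re s - d" if "z \<in> cball s d" for z
    using that abs_Re_le_cmod[of "s - z"] by (simp add: dist_norm)
  define C where "C = (\<lambda>s :: complex. of_nat (Suc K) * norm ((1 - s) gchoose Suc K) * 2 powr norm (1 - s) :: real)"
  have "continuous_on (cball s d) C"
    unfolding C_def gbinomial_prod_rev
    by (intro continuous_intros) (auto simp del: of_nat_Suc)
  hence "compact (C ` cball s d)" by (intro compact_continuous_image) auto
  then obtain B where B: "\<And>z. z \<in> cball s d \<Longrightarrow> norm (C z) \<le> B"
    by (metis compact_imp_bounded bounded_iff imageI)
  have "uniform_limit (cball s d) (\<lambda>m s. \<Sum>n<m. zeta_term K n s) (\<lambda>s. \<Sum>n. zeta_term K n s) sequentially"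
  proof (rule Weierstrass_m_test)
    fix n z assume z: "z \<in> cball s d"
    have "norm (zeta_term K n z) \<le> C z * real (Suc n) powr (- Re z - real K)"
      unfolding C_def by (rule zeta_term_bound)
    also have "\<dots> \<le> B * real (Suc n) powr (- (1 + d))"
      using B[OF z] Re[OF z]
      by (intro mult_mono powr_mono) (auto simp: d_def field_simps)
    finally show "norm (zeta_term K n z) \<le> B * real (Suc n) powr (- (1 + d))" .
  next
    show "summable (\<lambda>n. B * real (Suc n) powr (- (1 + d)))"
      using d by (intro summable_mult, subst summable_Suc_iff) (simp add: summable_real_powr_iff)
  qed
  moreover have "cball s d \<subseteq> {s. Re s > 1 - real K}"
    using Re d by (force simp: d_def field_simps)
  ultimately show "\<exists>d>0. cball s d \<subseteq> {s. Re s > 1 - real K} \<and>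
      uniform_limit (cball s d) (\<lambda>m s. \<Sum>n<m. zeta_term K n s) (\<lambda>s. \<Sum>n. zeta_term K n s) sequentially"
    using d by blast
qed

definition dirichlet_zeta :: "complex \<Rightarrow> complex" where
  "dirichlet_zeta s = (\<Sum>n. 1 / of_nat (Suc n) powr s)"

lemma dirichlet_zeta_sums:
  assumes "Re s > 1"
  shows "(\<lambda>n. 1 / of_nat (Suc n) powr s) sums dirichlet_zeta s"
proof -
  have "summable (\<lambda>n. real (Suc n) powr (- Re s))"
    using assms by (subst summable_Suc_iff) (simp add: summable_real_powr_iff)
  moreover have "norm (1 / of_nat (Suc n) powr s :: complex) = real (Suc n) powr (- Re s)" for n
    by (simp add: norm_divide norm_powr_real_powr powr_minus_divide del: of_nat_Suc)
  ultimately have "summable (\<lambda>n. norm (1 / of_nat (Suc n) powr s :: complex))"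
    by (simp only:)
  thus ?thesis
    unfolding dirichlet_zeta_def by (rule summable_sums[OF summable_norm_cancel])
qed

lemma zeta_term_sums:
  assumes "Re s > 1"
  shows "(\<lambda>n. zeta_term K n s) sums
           (- 1 - (\<Sum>k=1..K. ((1 - s) gchoose k) * dirichlet_zeta (s + of_nat k - 1)))"
proof -
  define a where "a = (\<lambda>n. of_nat (Suc n) powr (1 - s) :: complex)"
  have "a \<longlonglongrightarrow> 0"
    unfolding a_def using assms
    by (intro tendsto_neg_powr_complex_of_nat filterlim_Suc) auto
  hence "(\<lambda>n. a (Suc n) - a n) sums (0 - a 0)" by (rule telescope_sums)
  hence 1: "(\<lambda>n. a (Suc n) - a n) sums (- 1)" by (simp add: a_def)
  have "(\<lambda>n. \<Sum>k=1..K. ((1 - s) gchoose k) * (1 / of_nat (Suc n) powr (s + of_nat k - 1))) sums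
     (\<Sum>k=1..K. ((1 - s) gchoose k) * dirichlet_zeta (s + of_nat k - 1))"
    using assms by (intro sums_sum sums_mult dirichlet_zeta_sums) auto
  from sums_diff[OF 1 this] show ?thesis
  proof (rule sums_cong[THEN iffD1, rotated])
    fix n
    have "of_nat (Suc n) powr (1 - s - of_nat k) = 1 / (of_nat (Suc n) powr (s + of_nat k - 1) :: complex)" for k
      using powr_minus[of "of_nat (Suc n)" "s + of_nat k - 1"]
      by (simp add: inverse_eq_divide diff_diff_eq2 diff_diff_eq add.commute del: of_nat_Suc)
    note eq = this
    have "zeta_term K n s = a (Suc n) -
       (\<Sum>k\<le>K. ((1 - s) gchoose k) * (1 / of_nat (Suc n) powr (s + of_nat k - 1)))"
      unfolding zeta_term_def a_def eq ..
    also have "{..K} = insert 0 {1..K}" by auto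
    also have "(\<Sum>k\<in>insert 0 {1..K}. ((1 - s) gchoose k) * (1 / of_nat (Suc n) powr (s + of_nat k - 1))) =
      a n + (\<Sum>k=1..K. ((1 - s) gchoose k) * (1 / of_nat (Suc n) powr (s + of_nat k - 1)))"
      using powr_minus[of "of_nat (Suc n)" "s - 1"] by (simp add: a_def inverse_eq_divide del: of_nat_Suc)
    finally show "a (Suc n) - a n - (\<Sum>k=1..K. ((1 - s) gchoose k) * (1 / of_nat (Suc n) powr (s + of_nat k - 1)))
       = zeta_term K n s" by simp
  qed
qed

lemma zeta_halfplane_continuation:
  "\<exists>g. g holomorphic_on {s. Re s > - real m} \<and> (\<forall>s. Re s > 1 \<longrightarrow> g s = (s - 1) * dirichlet_zeta s)"
proof (induction m)
  have step: "\<exists>h. h holomorphic_on {s. Re s > - real m} \<and> (\<forall>s. Re s > 1 \<longrightarrow> h s = (s - 1) * dirichlet_zeta s)"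
    if g: "m > 0 \<Longrightarrow> g holomorphic_on {s. Re s > 1 - real m}"
      "\<And>s. m > 0 \<Longrightarrow> Re s > 1 \<Longrightarrow> g s = (s - 1) * dirichlet_zeta s" for g m
  proof (intro exI conjI allI impI)
    define h where "h = (\<lambda>s. 1 + (\<Sum>n. zeta_term (Suc m) n s) -
       (\<Sum>k=1..m. ((1 - s) gchoose k) / of_nat (Suc k) * g (s + of_nat k)))"
    have "(\<lambda>s. g (s + of_nat k)) holomorphic_on {s. Re s > - real m}" if "k \<in> {1..m}" for k
      using g(1) that
      by (intro holomorphic_on_compose_gen[of "\<lambda>s. s + of_nat k" _ g, unfolded o_def] holomorphic_intros) auto
    thus "h holomorphic_on {s. Re s > - real m}"
      unfolding h_def gbinomial_prod_rev using zeta_term_suminf_holomorphic[of "Suc m"]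
      by (intro holomorphic_intros) (auto simp del: of_nat_Suc simp: of_nat_Suc[where 'a = real])
    fix s :: complex assume s: "Re s > 1"
    have eq: "((1 - s) gchoose Suc k) * dirichlet_zeta (s + of_nat k) =
          - (((1 - s) gchoose k) / of_nat (Suc k) * g (s + of_nat k))" if "k \<in> {1..m}" for k
    proof -
      have "g (s + of_nat k) = (s + of_nat k - 1) * dirichlet_zeta (s + of_nat k)"
        using s that by (intro g(2)) auto
      moreover have "((1 - s) gchoose Suc k) = - (((1 - s) gchoose k) / of_nat (Suc k) * (s + of_nat k - 1))"
        using gbinomial_mult_1[of "1 - s" k] by (simp add: field_simps del: of_nat_Suc)
      ultimately show ?thesis by simp
    qed
    define F where "F = (\<lambda>k. ((1 - s) gchoose k) * dirichlet_zeta (s + of_nat k - 1))"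
    have "sum F {1..Suc m} = F 1 + (\<Sum>k=1..m. F (Suc k))"
      for m by (induction m) (auto simp: add_ac)
    from this[of m] have "(\<Sum>k=1..Suc m. ((1 - s) gchoose k) * dirichlet_zeta (s + of_nat k - 1)) =
       (1 - s) * dirichlet_zeta s + (\<Sum>k=1..m. ((1 - s) gchoose Suc k) * dirichlet_zeta (s + of_nat k))"
      unfolding F_def by (simp del: sum.cl_ivl_Suc)
    also have "(\<Sum>k=1..m. ((1 - s) gchoose Suc k) * dirichlet_zeta (s + of_nat k)) =
       - (\<Sum>k=1..m. ((1 - s) gchoose k) / of_nat (Suc k) * g (s + of_nat k))"
      unfolding sum_negf[symmetric] using eq by (intro sum.cong) auto
    finally have "(\<Sum>k=1..Suc m. ((1 - s) gchoose k) * dirichlet_zeta (s + of_nat k - 1)) =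
       (1 - s) * dirichlet_zeta s - (\<Sum>k=1..m. ((1 - s) gchoose k) / of_nat (Suc k) * g (s + of_nat k))"
      by (simp only: add_uminus_conv_diff)
    note sums_unique[OF zeta_term_sums[OF s, of "Suc m", unfolded this]]
    hence "h s = 1 + (- 1 - ((1 - s) * dirichlet_zeta s -
             (\<Sum>k=1..m. ((1 - s) gchoose k) / of_nat (Suc k) * g (s + of_nat k)))) -
             (\<Sum>k=1..m. ((1 - s) gchoose k) / of_nat (Suc k) * g (s + of_nat k))"
      unfolding h_def by (rule arg_cong[OF sym])
    also have "\<dots> = (s - 1) * dirichlet_zeta s"
      by (simp only: ring_distribs) simp
    finally show "h s = (s - 1) * dirichlet_zeta s" .
  qed
  {
    case 0
    show ?case by (rule step) auto
  next
    case (Suc m)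
    then obtain g where "g holomorphic_on {s. Re s > - real m}" "\<forall>s. Re s > 1 \<longrightarrow> g s = (s - 1) * dirichlet_zeta s"
      by blast
    thus ?case by (intro step[of "Suc m" g]) auto
  }
qed

lemma zeta_continuation_exists: "\<exists>f. zeta_continuation f \<and> f 1 = 0"
proof -
  from zeta_halfplane_continuation obtain g where
    g: "\<And>m. g m holomorphic_on {s. Re s > - real m}"
       "\<And>m s. Re s > 1 \<Longrightarrow> g m s = (s - 1) * dirichlet_zeta s"
    by metis
  define i where "i = (\<lambda>s. nat \<lceil>- Re s\<rceil> + 1)"
  define G where "G = (\<lambda>s. g (i s) s)"
  have i: "Re s > - real (i s)" for s
    unfolding i_def by linarith
  have same: "g m s = g l s" if "Re s > - real m" "m \<le> l" for m l s
  proof (rule analytic_continuation_open[of "{s. Re s > 1}" "{s. Re s > - real m}" "g m" "g l"])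
    show "{s. Re s > 1} \<noteq> {}" by (auto intro!: exI[of _ 2])
    show "g l holomorphic_on {s. Re s > - real m}"
      by (rule holomorphic_on_subset[OF g(1)]) (use that in auto)
    show "connected {s. Re s > - real m}"
      by (intro convex_connected convex_halfspace_Re_gt)
  qed (use that g in \<open>auto simp: open_halfspace_Re_gt\<close>)
  have G: "G s = g m s" if "Re s > - real m" for m s
    unfolding G_def using same[of m s "i s"] same[of "i s" s m] that i[of s] by (metis nle_le)
  have "G holomorphic_on (\<Union>m\<in>UNIV. {s. Re s > - real m})"
  proof (rule holomorphic_on_UN_open)
    show "G holomorphic_on {s. Re s > - real m}" for m
      using g(1)[of m] by (subst holomorphic_cong[OF refl G]) auto
  qed (auto simp: open_halfspace_Re_gt)
  also have "(\<Union>m\<in>UNIV. {s. Re s > - real m}) = UNIV"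
    using i by auto
  finally have holo: "G holomorphic_on UNIV" .
  define f where "f = (\<lambda>s. G s / (s - 1))"
  have "f holomorphic_on (- {1})"
    unfolding f_def by (intro holomorphic_intros holomorphic_on_subset[OF holo]) auto
  moreover have "f s = dirichlet_zeta s" if "Re s > 1" for s
  proof -
    have "s \<noteq> 1" using that by auto
    thus ?thesis using g(2)[OF that, of "i s"] by (simp add: f_def G_def)
  qed
  ultimately have "zeta_continuation f"
    unfolding zeta_continuation_def using dirichlet_zeta_sums by auto
  moreover have "f 1 = 0" by (simp add: f_def)
  ultimately show ?thesis by blast
qed

lemma zeta_continuation_unique:
  assumes "zeta_continuation f" "zeta_continuation g" "s \<noteq> 1"
  shows "f s = g s"
proof (rule analytic_continuation_open[of "{s. Re s > 1}" "- {1}" f g])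
  show "{s. Re s > 1} \<noteq> {}" by (auto intro!: exI[of _ 2])
  show "connected (- {1 :: complex})"
    by (rule connected_punctured_universe) simp
  show "f z = g z" if "z \<in> {s. Re s > 1}" for z
    using that assms(1,2) unfolding zeta_continuation_def by (metis sums_unique2 mem_Collect_eq)
qed (use assms in \<open>auto simp: open_halfspace_Re_gt zeta_continuation_def\<close>)

text \<open>The value at the pole is an arbitrary convention.\<close>

definition riemann_zeta :: "complex \<Rightarrow> complex" where
  "riemann_zeta = (THE f. zeta_continuation f \<and> f 1 = 0)"

lemma zeta_continuation_riemann_zeta: "zeta_continuation riemann_zeta"
proof -
  obtain f where f: "zeta_continuation f \<and> f 1 = 0" using zeta_continuation_exists by blast
  have "h = f" if "zeta_continuation h \<and> h 1 = 0" for h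
  proof
    fix s show "h s = f s"
      using zeta_continuation_unique[of h f s] f that by (cases "s = 1") auto
  qed
  with f have "riemann_zeta = f"
    unfolding riemann_zeta_def by (intro the_equality) blast+
  with f show ?thesis by simp
qed

text \<open>
  Principal branches throughout. The series converges when \<open>k + 2 * N > 1\<close> and
  \<open>x \<notin> \<real>\<^sub>\<le>\<^sub>0\<close>; outside that range the value is meaningless.
\<close>

definition ext_herglotz :: "real \<Rightarrow> real \<Rightarrow> complex \<Rightarrow> complex" where
  "ext_herglotz k N x =
     (\<Sum>n. 1 / of_real (real (Suc n) powr k) *
       (Digamma (of_real (real (Suc n) powr N) * x)
        - ln (of_real (real (Suc n) powr N) * x)
        + 1 / (2 * of_real (real (Suc n) powr N) * x)))"

definition herglotz_R :: "nat \<Rightarrow> complex \<Rightarrow> complex" where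
  "herglotz_R N x =
     (if N = 1 then 1 / (2 * x) * (ln (2 * of_real pi * x) - euler_mascheroni)
      else - (of_real pi * x powr (- 1 / of_nat N) * riemann_zeta (1 - 1 / of_nat N))
              / (of_nat N * sin (of_real pi / of_nat N))
           - 1 / (2 * x) * riemann_zeta (of_nat N))"

end

(*
  Write phi(z) = Digamma z - ln z + 1/(2z). Telescoping gives phi(z) = sum_{m >= 0} tau(z + m),
  where tau(w) = ln(w + 1) - ln w - (1/w + 1/(w + 1))/2 is the trapezoidal error of 1/w and is
  O(|w|^-3) along rays off the negative axis. So F_{0,N}(x) is the absolutely convergent double sum
  of tau(m + n^N x) over m >= 0 and n >= 1, and may be summed over n first.

  With om_k = exp(i pi (2k + 1 - N)/N) for k < N, and a_m = (m/x)^(1/N), the factorisation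
  m + n^N x = n^N x prod_k (1 + om_k a_m / n) turns the sums over n of ln(m + n^N x) and of
  1/(m + n^N x) into log-Gamma and Digamma values at om_k a_m (for N = 1 after subtracting a
  harmonic term). The Digamma values produce the dual Herglotz functions. The elementary terms come
  from the remaining sum over m <= M as M tends to infinity, by Stirling's formula along rays and by
  sum_{m <= M} m^-s - M^(1-s)/(1-s) --> zeta(s) at s = 1 - 1/N.
*)

theory Submission
  imports Defs "HOL-Real_Asymp.Real_Asymp"
begin

section \<open>Digamma and log-Gamma along rays\<close>

text \<open>Once the double sum is taken by columns, the logarithms and the reciprocals are summed
  over n separately, and what they contribute diverges separately as m grows. Only the combination
  up to a common M has a limit, so the proof keeps M finite and cancels growing terms. The constants
  have distinct sources. Each of the N log-Gamma values contributes ln(2 pi)/2, whence (2 pi)^N. The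
  part -1/(2m) of the column sum of reciprocals gives gamma/2. The half weight of the end m = 0
  gives -zeta(N)/(2x). The sum of om_k times i times its angle is -pi/sin(pi/N), and it multiplies
  the partial sums whose regularised limit is zeta(1 - 1/N). For N = 1 this sum vanishes while the
  sum of the om_k is 1 instead of 0, so logarithms of m replace powers of m, and Stirling's formula
  for M! replaces the zeta limit. The recurring obstacle is the branch of the logarithm: an identity
  between products gives one between logarithms only after the arguments are shown to stay inside
  (-pi, pi). This is where Re x > 0 is used.\<close>

lemma ray_norm_lower_bound:
  fixes c :: complex
  assumes "c \<notin> \<real>\<^sub>\<le>\<^sub>0"
  obtains \<delta> :: real where "\<delta> > 0"
    "\<And>s t :: real. 0 \<le> s \<Longrightarrow> 0 \<le> t \<Longrightarrow> \<delta> * (s + t) \<le> norm (of_real s + of_real t * c)"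
proof -
  \<comment> \<open>For s + t > 0 the vector s + t c is (s + t) times a point of this segment, so
    the distance of the segment from 0 serves as the constant.\<close>
  have "0 \<notin> closed_segment 1 c"
  proof
    assume "0 \<in> closed_segment 1 c"
    then obtain u where u: "0 \<le> u" "u \<le> 1" "(1 - u) *\<^sub>R 1 + u *\<^sub>R c = 0"
      by (auto simp: closed_segment_def)
    hence "u \<noteq> 0" by auto
    have "c = of_real (- ((1 - u) / u))"
      using u(3) \<open>u \<noteq> 0\<close> by (simp add: scaleR_conv_of_real field_simps add_eq_0_iff)
    moreover have "- ((1 - u) / u) \<le> 0" using u by simp
    ultimately show False using assms nonpos_Reals_of_real_iff by metis
  qed
  then obtain d where d: "d > 0" "\<And>z. z \<in> closed_segment 1 c \<Longrightarrow> d \<le> norm z"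
    using separate_point_closed[of "closed_segment 1 c" 0] by (auto simp: dist_norm)
  show ?thesis
  proof (rule that[OF d(1)])
    fix s t :: real assume st: "0 \<le> s" "0 \<le> t"
    show "d * (s + t) \<le> norm (of_real s + of_real t * c)"
    proof (cases "s + t = 0")
      case True
      thus ?thesis using st by simp
    next
      case False
      define u where "u = t / (s + t)"
      have u: "0 \<le> u" "u \<le> 1" "1 - u = s / (s + t)"
        using st False by (auto simp: u_def field_simps)
      have "d \<le> norm ((1 - u) *\<^sub>R 1 + u *\<^sub>R c)"
        using u(1,2) by (intro d) (auto simp: closed_segment_def)
      also have "(1 - u) *\<^sub>R 1 + u *\<^sub>R c = (of_real s + of_real t * c) / of_real (s + t)"
        unfolding u(3) by (simp add: scaleR_conv_of_real u_def add_divide_distrib)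
      finally show ?thesis
        using st False by (simp add: norm_divide field_simps del: of_real_add)
    qed
  qed
qed

lemma not_nonpos_Reals_add_of_real:
  fixes w :: complex
  assumes "w \<notin> \<real>\<^sub>\<le>\<^sub>0" "0 \<le> s"
  shows "w + of_real s \<notin> \<real>\<^sub>\<le>\<^sub>0"
  using assms by (auto simp: complex_nonpos_Reals_iff)

lemma not_nonpos_Reals_of_real_mult:
  fixes w :: complex
  assumes "w \<notin> \<real>\<^sub>\<le>\<^sub>0" "0 < s"
  shows "of_real s * w \<notin> \<real>\<^sub>\<le>\<^sub>0"
  using assms by (auto simp: complex_nonpos_Reals_iff mult_le_0_iff)

lemma unit_segmentE:
  assumes "z \<in> closed_segment (0::complex) 1"
  obtains s where "z = of_real s" "0 \<le> s" "s \<le> 1"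
  using assms by (auto simp: closed_segment_def scaleR_conv_of_real)

section \<open>Trapezoidal errors of the reciprocal and of the logarithm\<close>

definition digamma_step :: "complex \<Rightarrow> complex" where
  "digamma_step w = ln (w + 1) - ln w - (1 / w + 1 / (w + 1)) / 2"

text \<open>The error of the trapezoidal rule for the logarithm: the integral of \<open>ln\<close>
  from w to w + 1 minus the mean of its end values. Its derivative in w is
  \<open>digamma_step w\<close>.\<close>

definition stirling_step :: "complex \<Rightarrow> complex" where
  "stirling_step w = (w + 1 / 2) * (ln (w + 1) - ln w) - 1"

context
  fixes w :: complex and d :: real
  assumes w: "w \<notin> \<real>\<^sub>\<le>\<^sub>0" and d: "d > 0" "\<And>s. 0 \<le> s \<Longrightarrow> s \<le> 1 \<Longrightarrow> d \<le> norm (w + of_real s)"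
begin

text \<open>As a function of the interval length s, the trapezoidal error vanishes at s = 0 and has
  the derivative \<open>g'\<close>, in which the terms of lower order have cancelled. The mean value
  inequality on [0, 1] gives the bound.\<close>

lemma norm_digamma_step_le: "norm (digamma_step w) \<le> 1 / (2 * d ^ 3)"
proof -
  define g where "g = (\<lambda>s. ln (w + s) - ln w - s / 2 * (inverse w + inverse (w + s)))"
  define g' where "g' = (\<lambda>s. - s\<^sup>2 / (2 * w * (w + s)\<^sup>2))"
  have "norm (g 1 - g 0) \<le> 1 / (2 * d ^ 3) * norm (1 - 0 :: complex)"
  proof (rule field_differentiable_bound[where S = "closed_segment 0 1"])
    fix z assume "z \<in> closed_segment (0::complex) 1"
    then obtain s where s: "z = of_real s" "0 \<le> s" "s \<le> 1" by (rule unit_segmentE)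
    have nz: "w + z \<notin> \<real>\<^sub>\<le>\<^sub>0" using not_nonpos_Reals_add_of_real[OF w] s by simp
    hence nz': "w + z \<noteq> 0" "w \<noteq> 0" using w by auto
    have nz'': "w * 4 + z * 4 \<noteq> 0"
      using nz'(1) by (metis distrib_right mult_eq_0_iff zero_neq_numeral)
    show "(g has_field_derivative g' z) (at z within closed_segment 0 1)"
      unfolding g_def g'_def using nz nz' nz''
      by (auto intro!: derivative_eq_intros)
         (simp add: divide_simps power2_eq_square; simp add: algebra_simps)
    have "norm (g' z) = s\<^sup>2 / (2 * norm w * (norm (w + z))\<^sup>2)"
      using s by (simp add: g'_def norm_mult norm_divide norm_power)
    also have "\<dots> \<le> 1 / (2 * d * d\<^sup>2)"
      using s d d(2)[of s] d(2)[of 0]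
      by (intro frac_le mult_mono power_mono) (auto simp: power_le_one)
    finally show "norm (g' z) \<le> 1 / (2 * d ^ 3)" by (simp add: power3_eq_cube power2_eq_square)
  qed auto
  moreover have "g 1 - g 0 = digamma_step w"
    by (simp add: g_def digamma_step_def inverse_eq_divide)
  ultimately show ?thesis by simp
qed

text \<open>The error on an interval of length s vanishes at s = 0 together with its first
  derivative, so the mean value inequality is used twice: from \<open>g''\<close> to
  \<open>g'\<close> and from \<open>g'\<close> to \<open>g\<close>.\<close>

lemma norm_stirling_step_le: "norm (stirling_step w) \<le> 1 / (2 * d ^ 2)"
proof -
  define g where "g = (\<lambda>s. (w + s / 2) * (ln (w + s) - ln w) - s)"
  define g' where "g' = (\<lambda>s. (ln (w + s) - ln w) / 2 - 1 / 2 + w / 2 * inverse (w + s))"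
  define g'' where "g'' = (\<lambda>s. s / (2 * (w + s)\<^sup>2))"
  have g'_bound: "norm (g' z) \<le> 1 / (2 * d\<^sup>2)" if z: "z \<in> closed_segment 0 1" for z
  proof -
    have "norm (g' z - g' 0) \<le> 1 / (2 * d\<^sup>2) * norm (z - 0 :: complex)"
    proof (rule field_differentiable_bound[where S = "closed_segment 0 1"])
      fix z assume "z \<in> closed_segment (0::complex) 1"
      then obtain s where s: "z = of_real s" "0 \<le> s" "s \<le> 1" by (rule unit_segmentE)
      have nz: "w + z \<notin> \<real>\<^sub>\<le>\<^sub>0" using not_nonpos_Reals_add_of_real[OF w] s by simp
      hence nz': "w + z \<noteq> 0" by auto
      have nz'': "w * 2 + z * 2 \<noteq> 0"
        using nz' by (metis distrib_right mult_eq_0_iff zero_neq_numeral)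
      show "(g' has_field_derivative g'' z) (at z within closed_segment 0 1)"
        unfolding g'_def g''_def using nz nz' nz''
        by (auto intro!: derivative_eq_intros)
           (simp add: divide_simps power2_eq_square; simp add: algebra_simps)
      have "norm (g'' z) = s / (2 * (norm (w + z))\<^sup>2)"
        using s by (simp add: g''_def norm_mult norm_divide norm_power)
      also have "\<dots> \<le> 1 / (2 * d\<^sup>2)"
        using s d d(2)[of s] by (intro frac_le mult_mono power_mono) auto
      finally show "norm (g'' z) \<le> 1 / (2 * d\<^sup>2)" .
    qed (use z in auto)
    also have "\<dots> \<le> 1 / (2 * d\<^sup>2) * 1"
      by (rule mult_left_mono, rule unit_segmentE[OF z]) auto
    moreover have "w \<noteq> 0" using w by auto
    hence "g' 0 = 0" by (simp add: g'_def)
    ultimately show ?thesis by simp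
  qed
  have "norm (g 1 - g 0) \<le> 1 / (2 * d ^ 2) * norm (1 - 0 :: complex)"
  proof (rule field_differentiable_bound[where S = "closed_segment 0 1"])
    fix z assume z: "z \<in> closed_segment (0::complex) 1"
    then obtain s where s: "z = of_real s" "0 \<le> s" "s \<le> 1" by (rule unit_segmentE)
    have nz: "w + z \<notin> \<real>\<^sub>\<le>\<^sub>0" using not_nonpos_Reals_add_of_real[OF w] s by simp
    hence nz': "w + z \<noteq> 0" by auto
    have inv: "inverse (w + z) * (w + z / 2) - 1 = w * inverse (w + z) / 2 - 1 / 2"
      using left_inverse[OF nz'] by algebra
    show "(g has_field_derivative g' z) (at z within closed_segment 0 1)"
      unfolding g_def g'_def using nz nz' inv
      by (auto intro!: derivative_eq_intros)
    show "norm (g' z) \<le> 1 / (2 * d ^ 2)" using g'_bound[OF z] .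
  qed auto
  moreover have "g 1 - g 0 = stirling_step w"
    by (simp add: g_def stirling_step_def)
  ultimately show ?thesis by simp
qed

end

text \<open>Beyond the head 1/t^2, each term is at most a difference of consecutive values of 1/(m +
  t), and these differences telescope to 1/t.\<close>

lemma suminf_inverse_square_shift:
  fixes t :: real
  assumes "t > 0"
  shows "summable (\<lambda>m. 1 / (real m + t)\<^sup>2)" "(\<Sum>m. 1 / (real m + t)\<^sup>2) \<le> 1 / t\<^sup>2 + 1 / t"
proof -
  have "(\<lambda>m. 1 / (real m + t)) \<longlonglongrightarrow> 0" by real_asymp
  from telescope_sums'[OF this]
  have tel: "(\<lambda>m. 1 / (real m + t) - 1 / (real (Suc m) + t)) sums (1 / t)" by simp
  have le: "1 / (real (Suc m) + t)\<^sup>2 \<le> 1 / (real m + t) - 1 / (real (Suc m) + t)" for m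
  proof -
    have "1 / (real m + t) - 1 / (real (Suc m) + t) = 1 / ((real m + t) * (real (Suc m) + t))"
      using assms by (simp add: field_simps add_pos_nonneg add_nonneg_pos)
    also have "\<dots> \<ge> 1 / (real (Suc m) + t)\<^sup>2"
      unfolding power2_eq_square using assms by (intro divide_left_mono mult_right_mono) auto
    finally show ?thesis .
  qed
  have s: "summable (\<lambda>m. 1 / (real (Suc m) + t)\<^sup>2)"
    by (rule summable_comparison_test'[OF sums_summable[OF tel], of 0]) (use le in auto)
  thus s': "summable (\<lambda>m. 1 / (real m + t)\<^sup>2)" by (subst (asm) summable_Suc_iff)
  have "(\<Sum>m. 1 / (real (Suc m) + t)\<^sup>2) \<le> 1 / t"
    using suminf_le[OF le s sums_summable[OF tel]] tel by (simp add: sums_iff)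
  thus "(\<Sum>m. 1 / (real m + t)\<^sup>2) \<le> 1 / t\<^sup>2 + 1 / t"
    using suminf_split_head[OF s'] by simp
qed

text \<open>The product majorant makes the family absolutely summable over pairs, so unordered sums
  may be interchanged. The rest is the check that every series involved converges absolutely, where
  \<open>infsum\<close> and \<open>suminf\<close> agree.\<close>

lemma suminf_swap_dominated:
  fixes f :: "nat \<Rightarrow> nat \<Rightarrow> 'a :: banach"
  assumes "summable g" "summable h" "\<And>m n. norm (f m n) \<le> g m * h n" "\<And>m. g m \<ge> 0" "\<And>n. h n \<ge> 0"
  shows "(\<Sum>m. \<Sum>n. f m n) = (\<Sum>n. \<Sum>m. f m n)"
    and "summable (\<lambda>n. \<Sum>m. f m n)"
proof -
  have gh: "g summable_on UNIV" "h summable_on UNIV"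
    using assms by (auto simp: summable_on_UNIV_nonneg_real_iff)
  have sm: "summable (\<lambda>m. norm (f m n))" for n
    by (rule summable_comparison_test'[OF summable_mult2[OF assms(1), of "h n"], of 0]) (use assms in auto)
  have sn: "summable (\<lambda>n. norm (f m n))" for m
    by (rule summable_comparison_test'[OF summable_mult[OF assms(2), of "g m"], of 0]) (use assms in auto)
  have bn: "norm (\<Sum>m. f m n) \<le> suminf g * h n" for n
  proof -
    have "norm (\<Sum>m. f m n) \<le> (\<Sum>m. norm (f m n))" by (rule summable_norm[OF sm])
    also have "\<dots> \<le> (\<Sum>m. g m * h n)"
      by (intro suminf_le assms sm summable_mult2)
    also have "\<dots> = suminf g * h n" using assms(1) by (simp add: suminf_mult2)
    finally show ?thesis .
  qed
  have bm: "norm (\<Sum>n. f m n) \<le> g m * suminf h" for m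
  proof -
    have "norm (\<Sum>n. f m n) \<le> (\<Sum>n. norm (f m n))" by (rule summable_norm[OF sn])
    also have "\<dots> \<le> (\<Sum>n. g m * h n)"
      by (intro suminf_le assms sn summable_mult)
    also have "\<dots> = g m * suminf h" using assms(2) by (simp add: suminf_mult)
    finally show ?thesis .
  qed
  have sn': "summable (\<lambda>n. norm (\<Sum>m. f m n))"
    by (rule summable_comparison_test'[OF summable_mult[OF assms(2), of "suminf g"], of 0]) (use bn in auto)
  have sm': "summable (\<lambda>m. norm (\<Sum>n. f m n))"
    by (rule summable_comparison_test'[OF summable_mult2[OF assms(1), of "suminf h"], of 0]) (use bm in auto)
  show "summable (\<lambda>n. \<Sum>m. f m n)" using sn' by (rule summable_norm_cancel)
  have conv: "infsum F UNIV = suminf F" if "summable (\<lambda>n. norm (F n))" for F :: "nat \<Rightarrow> 'a"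
    using norm_summable_imp_has_sum[OF that summable_sums[OF summable_norm_cancel[OF that]]]
    by (rule infsumI)
  have "(\<lambda>(m, n). g m * h n) summable_on UNIV \<times> UNIV"
    by (rule summable_on_SigmaI[where g = "\<lambda>m. g m * infsum h UNIV"])
       (use gh assms in \<open>auto intro!: has_sum_cmult_right summable_on_cmult_left\<close>)
  hence "(\<lambda>p. norm (case p of (m, n) \<Rightarrow> f m n)) summable_on UNIV \<times> UNIV"
    by (rule Infinite_Sum.abs_summable_on_comparison_test') (use assms(3) in \<open>auto simp: case_prod_unfold\<close>)
  hence "(\<lambda>(m, n). f m n) summable_on UNIV \<times> UNIV"
    by (rule Infinite_Sum.abs_summable_summable)
  from infsum_swap_banach[OF this]
  show "(\<Sum>m. \<Sum>n. f m n) = (\<Sum>n. \<Sum>m. f m n)"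
    unfolding conv[OF sm] conv[OF sn] conv[OF sm'] conv[OF sn'] .
qed

text \<open>Both limits come from ln(1 + h)/h --> 1 at h = z/n. Dividing by the positive real n does
  not move the argument, so ln(z + n) - ln n is exactly ln(1 + z/n).\<close>

lemma ln_add_of_nat_asymp:
  fixes z :: complex
  assumes "z \<notin> \<real>\<^sub>\<le>\<^sub>0"
  shows "(\<lambda>n. of_nat n * (ln (z + of_nat n) - of_real (ln (real n)))) \<longlonglongrightarrow> z" (is ?th1)
    and "(\<lambda>n. ln (z + of_nat n) - of_real (ln (real n))) \<longlonglongrightarrow> 0" (is ?th2)
proof -
  have z: "z \<noteq> 0" using assms by auto
  have eq: "ln (z + of_nat n) - of_real (ln (real n)) = ln (1 + z / of_nat n)" if "n > 0" for n
  proof -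
    have "z + of_nat n \<noteq> 0"
      using not_nonpos_Reals_add_of_real[OF assms, of "real n"] by auto
    moreover have "1 + z / of_nat n = (z + of_nat n) / of_real (real n)"
      using that by (simp add: field_simps)
    ultimately show ?thesis using that by (simp add: Ln_divide_of_real del: of_real_of_nat_eq)
  qed
  have "((\<lambda>h. (ln (1 + h) - ln 1) / h) \<longlongrightarrow> inverse 1) (at (0::complex))"
    using has_field_derivative_Ln[of 1] unfolding DERIV_def by simp
  moreover have "filterlim (\<lambda>n. z / of_nat n) (at 0) sequentially"
  proof (rule filterlim_atI)
    show "(\<lambda>n. z / of_nat n) \<longlonglongrightarrow> 0" by (rule lim_const_over_n)
    show "\<forall>\<^sub>F n in sequentially. z / of_nat n \<noteq> 0"
      using eventually_gt_at_top[of 0] by eventually_elim (use z in auto)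
  qed
  ultimately have "(\<lambda>n. ln (1 + z / of_nat n) / (z / of_nat n)) \<longlonglongrightarrow> 1"
    using filterlim_compose by force
  hence "(\<lambda>n. z * (ln (1 + z / of_nat n) / (z / of_nat n))) \<longlonglongrightarrow> z * 1"
    by (intro tendsto_intros)
  thus 1: ?th1
    unfolding mult_1_right
    by (rule Lim_transform_eventually)
       (use eventually_gt_at_top[of 0] in \<open>eventually_elim, use z eq in \<open>auto simp: field_simps\<close>\<close>)
  have "(\<lambda>n. of_nat n * (ln (z + of_nat n) - of_real (ln (real n))) * (1 / of_nat n)) \<longlonglongrightarrow> z * 0"
    by (intro tendsto_mult 1 lim_1_over_n)
  thus ?th2
    unfolding mult_zero_right
    by (rule Lim_transform_eventually)
       (use eventually_gt_at_top[of 0] in \<open>eventually_elim, auto simp: field_simps\<close>)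
qed

lemma digamma_step_sums:
  assumes "z \<notin> \<real>\<^sub>\<le>\<^sub>0"
  shows "(\<lambda>m. digamma_step (z + of_nat m)) sums (Digamma z - ln z + 1 / (2 * z))"
proof -
  have z: "z \<noteq> 0" using assms by auto
  \<comment> \<open>Interior reciprocals occur twice with weight 1/2; the last summand corrects the
    two ends. The term ln n is inserted to form Euler's limit for \<open>Digamma z\<close>.\<close>
  have part: "(\<Sum>m<n. digamma_step (z + of_nat m)) =
      (of_real (ln (real n)) - (\<Sum>m<n. inverse (z + of_nat m))) +
      (ln (z + of_nat n) - of_real (ln (real n))) - ln z + (1 / z - inverse (z + of_nat n)) / 2" for n
  proof (induction n)
    case (Suc n)
    define a b where "a = inverse (z + of_nat n)" and "b = inverse (z + of_nat (Suc n))"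
    have step: "digamma_step (z + of_nat n) = ln (z + of_nat (Suc n)) - ln (z + of_nat n) - (a + b) / 2"
      by (simp add: digamma_step_def a_def b_def inverse_eq_divide add_ac)
    show ?case unfolding sum.lessThan_Suc Suc.IH step a_def[symmetric] b_def[symmetric]
      by (simp add: field_simps del: of_nat_Suc)
  qed (auto simp: inverse_eq_divide)
  have "filterlim (\<lambda>n. z + of_nat n) at_infinity sequentially"
    by (rule tendsto_add_filterlim_at_infinity[OF tendsto_const tendsto_of_nat])
  hence "(\<lambda>n. inverse (z + of_nat n)) \<longlonglongrightarrow> 0"
    by (rule filterlim_compose[OF tendsto_inverse_0])
  hence "(\<lambda>n. \<Sum>m<n. digamma_step (z + of_nat m)) \<longlonglongrightarrow> Digamma z + 0 - ln z + (1 / z - 0) / 2"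
    unfolding part by (intro tendsto_intros Digamma_LIMSEQ ln_add_of_nat_asymp assms z) auto
  thus ?thesis by (simp add: sums_def mult.commute)
qed

section \<open>Stirling's constant and Stirling's formula along rays\<close>

definition stirling_seq :: "nat \<Rightarrow> real" where
  "stirling_seq n = ln (fact n) - (real n + 1 / 2) * ln (real n) + real n"

text \<open>In terms of factorials, the logarithm of Wallis' product can be expressed by
  \<open>stirling_seq n\<close> and \<open>stirling_seq (2 * n)\<close>.\<close>

lemma wallis_product_fact:
  "(\<Prod>k=1..n. (4 * real k ^ 2) / (4 * real k ^ 2 - 1)) =
     2 ^ (4 * n) * fact n ^ 4 / (fact (2 * n) ^ 2 * (2 * real n + 1))"
proof (induction n)
  case (Suc n)
  define f where "f = (fact n :: real)"
  define F where "F = (fact (2 * n) :: real)"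
  have pos: "f > 0" "F > 0" by (auto simp: f_def F_def)
  have F': "fact (2 * Suc n) = (2 * real n + 2) * (2 * real n + 1) * F"
    by (simp add: F_def algebra_simps)
  have f': "fact (Suc n) = (real n + 1) * f" by (simp add: f_def algebra_simps)
  have q: "4 * real (Suc n) ^ 2 - 1 = (2 * real n + 1) * (2 * real n + 3)"
    by (simp add: power2_eq_square algebra_simps)
  have "(\<Prod>k=1..Suc n. (4 * real k ^ 2) / (4 * real k ^ 2 - 1)) =
      2 ^ (4 * n) * f ^ 4 / (F ^ 2 * (2 * real n + 1)) * ((4 * real (Suc n) ^ 2) / ((2 * real n + 1) * (2 * real n + 3)))"
    using Suc unfolding q[symmetric] f_def F_def by simp
  also have "\<dots> = 2 ^ (4 * Suc n) * ((real n + 1) * f) ^ 4 / (((2 * real n + 2) * (2 * real n + 1) * F) ^ 2 * (2 * real n + 3))"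
  proof -
    define a b c p where "a = 2 * real n + 1" and "b = real n + 1" and "c = 2 * real n + 3" and "p = (2::real) ^ (4 * n)"
    have ab: "a > 0" "b > 0" "c > 0" "2 * real n + 2 = 2 * b" "real (Suc n) = b" "(2::real) ^ (4 * Suc n) = 16 * p"
      by (auto simp: a_def b_def c_def p_def power_add)
    show ?thesis unfolding a_def[symmetric] b_def[symmetric] c_def[symmetric] ab(4-6) p_def[symmetric]
      using ab(1-3) pos by (simp add: field_simps power2_eq_square power4_eq_xxxx)
  qed
  finally show ?case unfolding F' f' by (simp add: algebra_simps)
qed auto

text \<open>The expressions (w - 1/2) ln w telescope, and the remaining sum of ln(z + m) is absorbed
  by the limit series of log-Gamma. Everything on the right converges as n grows. So the case z = 1
  shows that \<open>stirling_seq\<close> converges, and once its limit is known the same identity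
  evaluates the series for every z.\<close>

lemma stirling_step_partial_sums:
  assumes "z \<notin> \<real>\<^sub>\<le>\<^sub>0" "n > 0"
  shows "(\<Sum>m<n. stirling_step (z + of_nat m)) + of_real (stirling_seq n) =
     ln_Gamma_series z n - (z - 1 / 2) * ln z
       + (z + 1 / 2) * (ln (z + of_nat n) - of_real (ln (real n)))
       + of_nat n * (ln (z + of_nat n) - of_real (ln (real n)))"
proof -
  have part: "(\<Sum>m<n. stirling_step (z + of_nat m)) =
      (z + of_nat n - 1 / 2) * ln (z + of_nat n) - (z - 1 / 2) * ln z - (\<Sum>m<n. ln (z + of_nat m)) - of_nat n" for n
    by (induction n) (auto simp: stirling_step_def algebra_simps)
  have "(\<Sum>k=1..n. ln (z / of_nat k + 1)) = (\<Sum>k=1..n. ln (z + of_nat k) - of_real (ln (real k)))"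
  proof (rule sum.cong)
    fix k assume k: "k \<in> {1..n}"
    have "z + of_nat k \<noteq> 0"
      using not_nonpos_Reals_add_of_real[OF assms(1), of "real k"] by auto
    moreover have "z / of_nat k + 1 = (z + of_nat k) / of_real (real k)"
      using k by (simp add: field_simps)
    ultimately show "ln (z / of_nat k + 1) = ln (z + of_nat k) - of_real (ln (real k))"
      using k by (simp add: Ln_divide_of_real del: of_real_of_nat_eq)
  qed auto
  also have "\<dots> = (\<Sum>m<n. ln (z + of_nat m)) + ln (z + of_nat n) - ln z - of_real (ln (fact n))"
  proof (induction n)
    case (Suc n)
    have "ln (fact (Suc n) :: real) = ln (real (Suc n)) + ln (fact n)"
      by (simp add: ln_mult)
    thus ?case using Suc by simp
  qed auto
  finally have "ln_Gamma_series z n = z * of_real (ln (real n)) - ln z -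
      ((\<Sum>m<n. ln (z + of_nat m)) + ln (z + of_nat n) - ln z - of_real (ln (fact n)))"
    using assms(2) Ln_of_real[of "real n"] by (simp add: ln_Gamma_series_def)
  thus ?thesis
    unfolding part stirling_seq_def by (simp add: algebra_simps)
qed

text \<open>On a fixed ray the m-th term is O(1/(m + t)^2), with a constant that depends only on the
  direction c. Summation over m costs one power of t.\<close>

lemma stirling_step_ray_bound:
  fixes c :: complex
  assumes "c \<notin> \<real>\<^sub>\<le>\<^sub>0"
  obtains C :: real where "C \<ge> 0"
    "\<And>t. t > 0 \<Longrightarrow> summable (\<lambda>m. stirling_step (of_real t * c + of_nat m))"
    "\<And>t. t \<ge> 1 \<Longrightarrow> norm (\<Sum>m. stirling_step (of_real t * c + of_nat m)) \<le> C / t"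
proof -
  obtain \<delta> where \<delta>: "\<delta> > 0"
    "\<And>s t :: real. 0 \<le> s \<Longrightarrow> 0 \<le> t \<Longrightarrow> \<delta> * (s + t) \<le> norm (of_real s + of_real t * c)"
    using ray_norm_lower_bound[OF assms] by blast
  define D where "D = 1 / (2 * \<delta>\<^sup>2)"
  have D: "D \<ge> 0" by (simp add: D_def)
  have bound: "norm (stirling_step (of_real t * c + of_nat m)) \<le> D * (1 / (real m + t)\<^sup>2)" if t: "t > 0" for t m
  proof -
    have "norm (stirling_step (of_real t * c + of_nat m)) \<le> 1 / (2 * (\<delta> * (real m + t))\<^sup>2)"
    proof (rule norm_stirling_step_le)
      show "of_real t * c + of_nat m \<notin> \<real>\<^sub>\<le>\<^sub>0"
        using not_nonpos_Reals_add_of_real[OF not_nonpos_Reals_of_real_mult[OF assms t], of "real m"] by simp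
      show "0 < \<delta> * (real m + t)" using \<delta> t by simp
      fix s :: real assume s: "0 \<le> s" "s \<le> 1"
      have "\<delta> * (real m + t) \<le> \<delta> * (real m + s + t)" using \<delta> s by simp
      also have "\<dots> \<le> norm (of_real (real m + s) + of_real t * c)" using s t by (intro \<delta>) auto
      finally show "\<delta> * (real m + t) \<le> norm (of_real t * c + of_nat m + of_real s)" by (simp add: add_ac)
    qed
    thus ?thesis by (simp add: D_def power_mult_distrib)
  qed
  have norm_summable: "summable (\<lambda>m. norm (stirling_step (of_real t * c + of_nat m)))" if "t > 0" for t
    by (rule summable_comparison_test'[OF summable_mult[OF suminf_inverse_square_shift(1)[OF that]], of 0])
       (use bound[OF that] in auto)
  show ?thesis
  proof (rule that[of "2 * D"])
    show "2 * D \<ge> 0" using D by simp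
    show "summable (\<lambda>m. stirling_step (of_real t * c + of_nat m))" if "t > 0" for t
      by (rule summable_norm_cancel[OF norm_summable[OF that]])
    fix t :: real assume t: "t \<ge> 1"
    hence t0: "t > 0" by simp
    have "norm (\<Sum>m. stirling_step (of_real t * c + of_nat m)) \<le> (\<Sum>m. norm (stirling_step (of_real t * c + of_nat m)))"
      by (rule summable_norm[OF norm_summable[OF t0]])
    also have "\<dots> \<le> (\<Sum>m. D * (1 / (real m + t)\<^sup>2))"
      by (intro suminf_le bound t0 norm_summable summable_mult suminf_inverse_square_shift)
    also have "\<dots> = D * (\<Sum>m. 1 / (real m + t)\<^sup>2)"
      by (intro suminf_mult suminf_inverse_square_shift t0)
    also have "\<dots> \<le> D * (1 / t + 1 / t)"
    proof (rule mult_left_mono)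
      have "1 / t\<^sup>2 \<le> 1 / t" using t by (simp add: power2_eq_square divide_simps)
      thus "(\<Sum>m. 1 / (real m + t)\<^sup>2) \<le> 1 / t + 1 / t"
        using suminf_inverse_square_shift(2)[OF t0] by linarith
    qed (use D t in auto)
    finally show "norm (\<Sum>m. stirling_step (of_real t * c + of_nat m)) \<le> 2 * D / t" by (simp add: mult.commute)
  qed
qed

text \<open>Convergence follows from the partial-sum identity at z = 1. In the logarithm of Wallis'
  product the unknown limit C enters as 4 C - 2 C, and comparison with ln(pi/2) determines
  it.\<close>

lemma stirling_seq_limit: "stirling_seq \<longlonglongrightarrow> ln (2 * pi) / 2"
proof -
  have one: "(1::complex) \<notin> \<real>\<^sub>\<le>\<^sub>0" by (simp add: complex_nonpos_Reals_iff)
  have nnI: "(1::complex) \<notin> \<int>\<^sub>\<le>\<^sub>0" using one by (metis nonpos_Ints_subset_nonpos_Reals subsetD)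
  obtain T where T: "(\<lambda>n. \<Sum>m<n. stirling_step (1 + of_nat m)) \<longlonglongrightarrow> T"
    using stirling_step_ray_bound[OF one] unfolding summable_def sums_def
    by (metis mult_1 of_real_1 zero_less_one)
  have "(\<lambda>n. ln_Gamma_series 1 n - (1 - 1 / 2) * ln 1
       + (1 + 1 / 2) * (ln (1 + of_nat n) - of_real (ln (real n)))
       + of_nat n * (ln (1 + of_nat n) - of_real (ln (real n))) - (\<Sum>m<n. stirling_step (1 + of_nat m)))
    \<longlonglongrightarrow> ln_Gamma 1 - (1 - 1 / 2) * ln 1 + (1 + 1 / 2) * 0 + 1 - T" (is "_ \<longlonglongrightarrow> ?L")
    by (intro tendsto_intros ln_Gamma_complex_LIMSEQ ln_add_of_nat_asymp T one nnI)
  hence "(\<lambda>n. complex_of_real (stirling_seq n)) \<longlonglongrightarrow> ?L"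
    by (rule Lim_transform_eventually)
       (use eventually_gt_at_top[of 0] in \<open>eventually_elim, use stirling_step_partial_sums[OF one] in \<open>simp add: algebra_simps\<close>\<close>)
  from tendsto_Re[OF this] obtain C where C: "stirling_seq \<longlonglongrightarrow> C" by auto
  have "filterlim (\<lambda>n::nat. 2 * n) at_top sequentially" by real_asymp
  hence C2: "(\<lambda>n. stirling_seq (2 * n)) \<longlonglongrightarrow> C" by (rule filterlim_compose[OF C])
  \<comment> \<open>This is what is left of the logarithm of Wallis' product when the
    \<open>stirling_seq\<close> terms are removed.\<close>
  have "(\<lambda>n. ln (real n) - ln 2 - ln (2 * real n + 1)) \<longlonglongrightarrow> - 2 * ln 2" by real_asymp
  hence "(\<lambda>n. ln (real n) - ln 2 - ln (2 * real n + 1) + 4 * stirling_seq n - 2 * stirling_seq (2 * n))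
       \<longlonglongrightarrow> - 2 * ln 2 + 4 * C - 2 * C"
    by (intro tendsto_intros C C2)
  hence lim: "(\<lambda>n. ln (\<Prod>k=1..n. (4 * real k ^ 2) / (4 * real k ^ 2 - 1))) \<longlonglongrightarrow> - 2 * ln 2 + 4 * C - 2 * C"
  proof (rule Lim_transform_eventually)
    show "\<forall>\<^sub>F n in sequentially. ln (real n) - ln 2 - ln (2 * real n + 1) + 4 * stirling_seq n - 2 * stirling_seq (2 * n)
      = ln (\<Prod>k=1..n. (4 * real k ^ 2) / (4 * real k ^ 2 - 1))"
      using eventually_gt_at_top[of 0]
    proof eventually_elim
      case (elim n)
      have "ln (\<Prod>k=1..n. (4 * real k ^ 2) / (4 * real k ^ 2 - 1)) =
         4 * real n * ln 2 + 4 * ln (fact n) - (2 * ln (fact (2 * n)) + ln (2 * real n + 1))"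
        unfolding wallis_product_fact by (simp add: ln_div ln_mult ln_realpow)
      moreover have "ln (2 * real n) = ln 2 + ln (real n)" using elim by (simp add: ln_mult)
      ultimately show ?case by (simp add: stirling_seq_def algebra_simps)
    qed
  qed
  have "(\<lambda>n. ln (\<Prod>k=1..n. (4 * real k ^ 2) / (4 * real k ^ 2 - 1))) \<longlonglongrightarrow> ln (pi / 2)"
    by (intro tendsto_ln wallis) auto
  from LIMSEQ_unique[OF this lim] have "C = ln (2 * pi) / 2"
    by (simp add: ln_div ln_mult)
  with C show ?thesis by simp
qed

lemma stirling_step_sums:
  assumes "z \<notin> \<real>\<^sub>\<le>\<^sub>0"
  shows "(\<lambda>m. stirling_step (z + of_nat m)) sums
           (ln_Gamma z - (z - 1 / 2) * ln z + z - of_real (ln (2 * pi) / 2))"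
proof -
  have nnI: "z \<notin> \<int>\<^sub>\<le>\<^sub>0" using assms by (metis nonpos_Ints_subset_nonpos_Reals subsetD)
  have "(\<lambda>n. ln_Gamma_series z n - (z - 1 / 2) * ln z
       + (z + 1 / 2) * (ln (z + of_nat n) - of_real (ln (real n)))
       + of_nat n * (ln (z + of_nat n) - of_real (ln (real n))) - of_real (stirling_seq n))
    \<longlonglongrightarrow> ln_Gamma z - (z - 1 / 2) * ln z + (z + 1 / 2) * 0 + z - of_real (ln (2 * pi) / 2)"
    by (intro tendsto_intros ln_Gamma_complex_LIMSEQ ln_add_of_nat_asymp assms nnI stirling_seq_limit)
  thus ?thesis unfolding sums_def mult_zero_right add_0_right
    by (rule Lim_transform_eventually)
       (use eventually_gt_at_top[of 0] in \<open>eventually_elim, use stirling_step_partial_sums[OF assms] in \<open>simp add: algebra_simps\<close>\<close>)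
qed

lemma ln_Gamma_ray_asymp:
  fixes c :: complex and t :: "'a \<Rightarrow> real"
  assumes "c \<notin> \<real>\<^sub>\<le>\<^sub>0" "filterlim t at_top F"
  shows "((\<lambda>n. let z = of_real (t n) * c in
      ln_Gamma z - (z - 1 / 2) * ln z + z - of_real (ln (2 * pi) / 2)) \<longlongrightarrow> 0) F"
proof -
  obtain C where C: "\<And>t :: real. t \<ge> 1 \<Longrightarrow> norm (\<Sum>m. stirling_step (of_real t * c + of_nat m)) \<le> C / t"
    using stirling_step_ray_bound[OF assms(1)] by metis
  show ?thesis
  proof (rule Lim_null_comparison)
    show "((\<lambda>n. C / t n) \<longlongrightarrow> 0) F"
      by (rule real_tendsto_divide_at_top[OF tendsto_const assms(2)])
    have "\<forall>\<^sub>F n in F. t n \<ge> 1" using assms(2) by (simp add: filterlim_at_top)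
    thus "\<forall>\<^sub>F n in F. norm (let z = of_real (t n) * c in
      ln_Gamma z - (z - 1 / 2) * ln z + z - of_real (ln (2 * pi) / 2)) \<le> C / t n"
    proof eventually_elim
      case (elim n)
      hence "of_real (t n) * c \<notin> \<real>\<^sub>\<le>\<^sub>0" by (intro not_nonpos_Reals_of_real_mult assms) auto
      from stirling_step_sums[OF this] C[OF elim] show ?case by (simp add: sums_iff Let_def)
    qed
  qed
qed

text \<open>The terms are cubic in 1/(m + t). One factor is bounded by 1/t, and the remaining
  squares sum to O(1/t), which gives the square of 1/t. This decay makes the dual Herglotz series
  converge.\<close>

lemma digamma_remainder_ray_bound:
  fixes c :: complex
  assumes "c \<notin> \<real>\<^sub>\<le>\<^sub>0"
  obtains C :: real where "\<And>t :: real. t \<ge> 1 \<Longrightarrow>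
    norm (Digamma (of_real t * c) - ln (of_real t * c) + 1 / (2 * (of_real t * c))) \<le> C / t\<^sup>2"
proof -
  obtain \<delta> where \<delta>: "\<delta> > 0"
    "\<And>s t :: real. 0 \<le> s \<Longrightarrow> 0 \<le> t \<Longrightarrow> \<delta> * (s + t) \<le> norm (of_real s + of_real t * c)"
    using ray_norm_lower_bound[OF assms] by blast
  define D where "D = 1 / (2 * \<delta> ^ 3)"
  have D: "D \<ge> 0" using \<delta> by (simp add: D_def)
  show ?thesis
  proof (rule that[of "2 * D"])
    fix t :: real assume t: "t \<ge> 1"
    hence t0: "t > 0" by simp
    have nz: "of_real t * c \<notin> \<real>\<^sub>\<le>\<^sub>0" by (rule not_nonpos_Reals_of_real_mult[OF assms t0])
    have bound: "norm (digamma_step (of_real t * c + of_nat m)) \<le> D / t * (1 / (real m + t)\<^sup>2)" for m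
    proof -
      have "norm (digamma_step (of_real t * c + of_nat m)) \<le> 1 / (2 * (\<delta> * (real m + t)) ^ 3)"
      proof (rule norm_digamma_step_le)
        show "of_real t * c + of_nat m \<notin> \<real>\<^sub>\<le>\<^sub>0"
          using not_nonpos_Reals_add_of_real[OF nz, of "real m"] by simp
        show "0 < \<delta> * (real m + t)" using \<delta> t by simp
        fix s :: real assume s: "0 \<le> s" "s \<le> 1"
        have "\<delta> * (real m + t) \<le> \<delta> * (real m + s + t)" using \<delta> s by simp
        also have "\<dots> \<le> norm (of_real (real m + s) + of_real t * c)" using s t by (intro \<delta>) auto
        finally show "\<delta> * (real m + t) \<le> norm (of_real t * c + of_nat m + of_real s)" by (simp add: add_ac)
      qed
      also have "\<dots> = D * (1 / (real m + t) * (1 / (real m + t)\<^sup>2))"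
        by (simp add: D_def power_mult_distrib power3_eq_cube power2_eq_square)
      also have "\<dots> \<le> D * (1 / t * (1 / (real m + t)\<^sup>2))"
        using t D by (intro mult_left_mono mult_right_mono divide_left_mono) auto
      finally show ?thesis by simp
    qed
    have norm_summable: "summable (\<lambda>m. norm (digamma_step (of_real t * c + of_nat m)))"
      by (rule summable_comparison_test'[OF summable_mult[OF suminf_inverse_square_shift(1)[OF t0], of "D / t"], of 0])
         (use bound in auto)
    have "norm (\<Sum>m. digamma_step (of_real t * c + of_nat m)) \<le> (\<Sum>m. norm (digamma_step (of_real t * c + of_nat m)))"
      by (rule summable_norm[OF norm_summable])
    also have "\<dots> \<le> (\<Sum>m. D / t * (1 / (real m + t)\<^sup>2))"
      by (intro suminf_le bound norm_summable summable_mult suminf_inverse_square_shift t0)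
    also have "\<dots> = D / t * (\<Sum>m. 1 / (real m + t)\<^sup>2)"
      by (intro suminf_mult suminf_inverse_square_shift t0)
    also have "\<dots> \<le> D / t * (1 / t + 1 / t)"
    proof (rule mult_left_mono)
      have "1 / t\<^sup>2 \<le> 1 / t" using t by (simp add: power2_eq_square divide_simps)
      thus "(\<Sum>m. 1 / (real m + t)\<^sup>2) \<le> 1 / t + 1 / t"
        using suminf_inverse_square_shift(2)[OF t0] by linarith
    qed (use D t in auto)
    finally show "norm (Digamma (of_real t * c) - ln (of_real t * c) + 1 / (2 * (of_real t * c))) \<le> 2 * D / t\<^sup>2"
      using digamma_step_sums[OF nz] by (simp add: sums_iff power2_eq_square mult.commute[of D])
  qed
qed

text \<open>The series belongs to Digamma(z + 1); the recurrence moves it to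
  \<open>Digamma z\<close>, the form in which the dual Herglotz function uses it.\<close>

lemma Digamma_sums':
  assumes "z \<notin> \<real>\<^sub>\<le>\<^sub>0"
  shows "(\<lambda>n. 1 / (of_nat (Suc n) + z) - 1 / of_nat (Suc n)) sums (- (Digamma z + 1 / z + euler_mascheroni) :: complex)"
proof -
  have z: "z \<noteq> 0" "z + 1 \<noteq> 0" using assms not_nonpos_Reals_add_of_real[OF assms, of 1] by auto
  have "(\<lambda>k. inverse (of_nat (Suc k)) - inverse (z + 1 + of_nat k)) sums (Digamma (z + 1) + euler_mascheroni)"
    using summable_sums[OF summable_Digamma[OF z(2)]] by (simp add: Digamma_def)
  from sums_minus[OF this]
  have "(\<lambda>k. - (inverse (of_nat (Suc k)) - inverse (z + 1 + of_nat k))) sums (- (Digamma z + 1 / z + euler_mascheroni))"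
    by (simp only: Digamma_plus1[OF z(1)])
  moreover have "- (inverse (of_nat (Suc k)) - inverse (z + 1 + of_nat k)) = 1 / (of_nat (Suc k) + z) - 1 / of_nat (Suc k)" for k
    by (simp add: inverse_eq_divide add_ac)
  ultimately show ?thesis by (simp only:)
qed

section \<open>The roots of $(-z)^N = -1$\<close>

text \<open>For k < N these arguments are symmetric about 0 and stay at least pi/N away from pi and
  -pi, which leaves room for the argument of x^(-1/N).\<close>

definition herglotz_angle :: "nat \<Rightarrow> nat \<Rightarrow> real" where
  "herglotz_angle N k = pi * (2 * real k + 1 - real N) / real N"

definition herglotz_root :: "nat \<Rightarrow> nat \<Rightarrow> complex" where
  "herglotz_root N k = cis (herglotz_angle N k)"

text \<open>With the sign reversed, the roots are a fixed factor times the powers of a primitive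
  N-th root of unity, so their power sums become geometric sums.\<close>

lemma minus_herglotz_root:
  assumes "N \<ge> 1"
  shows "- herglotz_root N k = cis (pi / real N) * cis (2 * pi / real N) ^ k"
proof -
  have "- herglotz_root N k = cis pi * herglotz_root N k" by simp
  also have "\<dots> = cis (pi / real N + real k * (2 * pi / real N))"
    unfolding herglotz_root_def cis_mult herglotz_angle_def using assms
    by (intro arg_cong[of _ _ cis]) (simp add: field_simps)
  finally show ?thesis by (simp add: Complex.DeMoivre cis_mult)
qed

lemma minus_herglotz_root_power:
  assumes "N \<ge> 1"
  shows "(- herglotz_root N k) ^ N = -1"
proof -
  have "(cis (2 * pi / real N) ^ k) ^ N = (cis (2 * pi / real N) ^ N) ^ k"
    by (simp only: power_mult [symmetric] mult.commute)
  also have "cis (2 * pi / real N) ^ N = 1"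
    using assms by (simp add: Complex.DeMoivre)
  finally show ?thesis
    unfolding minus_herglotz_root[OF assms] power_mult_distrib
    using assms by (simp add: Complex.DeMoivre)
qed

lemma cis_power_ne_1:
  assumes "0 < l" "l < N"
  shows "cis (2 * pi / real N) ^ l \<noteq> 1"
proof
  assume "cis (2 * pi / real N) ^ l = 1"
  hence "cos (real l * (2 * pi / real N)) = 1"
    by (metis Complex.DeMoivre cis.sel(1) one_complex.sel(1))
  then obtain j :: int where j: "real l * (2 * pi / real N) = of_int j * 2 * pi"
    using cos_one_2pi_int by blast
  have "real l = of_int j * real N" using j assms by (simp add: field_simps)
  hence "int l = j * int N" by (metis of_int_eq_iff of_int_mult of_int_of_nat_eq)
  hence "int N dvd int l" by simp
  thus False using assms by (simp add: nat_dvd_not_less)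
qed

lemma cis_geometric_sum:
  assumes "0 < l" "l < N"
  shows "(\<Sum>k<N. (cis (2 * pi / real N) ^ l) ^ k) = 0"
proof -
  have "(cis (2 * pi / real N) ^ l) ^ N = (cis (2 * pi / real N) ^ N) ^ l"
    by (simp only: power_mult [symmetric] mult.commute)
  also have "cis (2 * pi / real N) ^ N = 1"
    using assms by (simp add: Complex.DeMoivre)
  finally show ?thesis using cis_power_ne_1[OF assms] by (simp add: geometric_sum)
qed

lemma sum_minus_herglotz_root_power:
  assumes "0 < l" "l < N"
  shows "(\<Sum>k<N. (- herglotz_root N k) ^ l) = 0"
proof -
  have N: "N \<ge> 1" using assms by simp
  have "(\<Sum>k<N. (- herglotz_root N k) ^ l) = cis (pi / real N) ^ l * (\<Sum>k<N. (cis (2 * pi / real N) ^ l) ^ k)"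
    unfolding minus_herglotz_root[OF N] sum_distrib_left
    by (intro sum.cong) (simp_all add: power_mult_distrib power_mult [symmetric] mult.commute)
  thus ?thesis using cis_geometric_sum[OF assms] by simp
qed

lemma sum_herglotz_root:
  assumes "N \<ge> 1"
  shows "(\<Sum>k<N. herglotz_root N k) = (if N = 1 then 1 else 0)"
proof (cases "N = 1")
  case True
  thus ?thesis by (simp add: herglotz_root_def herglotz_angle_def)
next
  case False
  thus ?thesis using sum_minus_herglotz_root_power[of 1 N] assms by (simp add: sum_negf)
qed

lemma sum_herglotz_angle:
  assumes "N \<ge> 1"
  shows "(\<Sum>k<N. herglotz_angle N k) = 0"
proof -
  have "(\<Sum>k<n. 2 * real k + 1 - a) = real n * (real n - a)" for n a
    by (induction n) (auto simp: algebra_simps)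
  hence "pi / real N * (\<Sum>k<N. 2 * real k + 1 - real N) = 0" by simp
  thus ?thesis by (simp add: herglotz_angle_def sum_distrib_left)
qed

text \<open>A differentiated geometric sum with its denominator cleared. For an N-th root of unity q
  other than 1 and n = N, the right side reduces to N.\<close>

lemma sum_mult_power:
  fixes q :: "'a :: comm_ring_1"
  shows "(q - 1) * (\<Sum>k<n. of_nat k * q ^ k) = of_nat n * q ^ n - q * (\<Sum>k<n. q ^ k)"
  by (induction n) (auto simp: algebra_simps)

text \<open>The angle is affine in k. Its constant part is killed by the vanishing sum of the q^k,
  and its linear part produces N/(q - 1), where q - 1 = 2 i e sin(pi/N). This is the origin of
  pi/sin(pi/N) in \<open>herglotz_R\<close>.\<close>

lemma sum_herglotz_root_angle:
  assumes "N \<ge> 2"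
  shows "(\<Sum>k<N. herglotz_root N k * (\<i> * of_real (herglotz_angle N k))) = - of_real pi / sin (of_real pi / of_nat N)"
proof -
  have N: "N \<ge> 1" using assms by simp
  define e where "e = cis (pi / real N)"
  define q where "q = cis (2 * pi / real N)"
  define s where "s = sin (of_real pi / of_nat N :: complex)"
  have e: "e * cis (- (pi / real N)) = 1" by (simp add: e_def cis_mult)
  have qe: "q = e * e" by (simp add: q_def e_def cis_mult)
  have q: "q ^ N = 1" using assms by (simp add: q_def Complex.DeMoivre)
  have sq: "(\<Sum>k<N. q ^ k) = 0" using cis_geometric_sum[of 1 N] assms by (simp add: q_def)
  have q1: "q \<noteq> 1" using cis_power_ne_1[of 1 N] assms by (simp add: q_def)
  have "s = of_real (sin (pi / real N))" by (simp add: s_def sin_of_real [symmetric])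
  hence "2 * \<i> * s = e - cis (- (pi / real N))"
    by (auto simp: e_def complex_eq_iff)
  hence "e * (2 * \<i> * s) = e * e - e * cis (- (pi / real N))" by (simp add: right_diff_distrib)
  hence es: "e * (2 * \<i> * s) = q - 1" by (simp only: e qe)
  have root: "herglotz_root N k = - e * q ^ k" for k
    using minus_herglotz_root[OF N, of k] by (simp add: e_def q_def minus_equation_iff[of "herglotz_root N k"])
  have angle: "herglotz_angle N k = herglotz_angle N 0 + 2 * pi / real N * real k" for k
    using N by (simp add: herglotz_angle_def field_simps)
  have "(\<Sum>k<N. herglotz_root N k * (\<i> * of_real (herglotz_angle N k))) =
      (\<Sum>k<N. - e * \<i> * of_real (herglotz_angle N 0) * q ^ k - e * \<i> * (2 * of_real pi / of_nat N) * (of_nat k * q ^ k))"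
    unfolding root by (intro sum.cong refl) (subst angle, simp add: algebra_simps)
  also have "\<dots> = - e * \<i> * of_real (herglotz_angle N 0) * (\<Sum>k<N. q ^ k)
      - e * \<i> * (2 * of_real pi / of_nat N) * (\<Sum>k<N. of_nat k * q ^ k)"
    by (simp only: sum_subtractf sum_distrib_left)
  also have "(\<Sum>k<N. of_nat k * q ^ k) = of_nat N / (q - 1)"
    using sum_mult_power[of q N] q1 unfolding sq q by (simp add: field_simps)
  also have "- e * \<i> * of_real (herglotz_angle N 0) * (\<Sum>k<N. q ^ k)
      - e * \<i> * (2 * of_real pi / of_nat N) * (of_nat N / (q - 1)) = - (e * (2 * \<i>) * of_real pi / (e * (2 * \<i> * s)))"
    unfolding sq es using N by simp
  also have "\<dots> = - of_real pi / s"
  proof -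
    have "s \<noteq> 0" "e \<noteq> 0" using es q1 by (auto simp: e_def)
    thus ?thesis by (simp add: field_simps)
  qed
  finally show ?thesis by (simp add: s_def)
qed

text \<open>This is the logarithmic derivative in b of the product of all 1 +
  \<open>herglotz_root N k\<close> b, which is 1 + b^N, with the denominator cleared. With r =
  \<open>- herglotz_root N k\<close> one has 1 + b^N = 1 - (r b)^N, so each quotient is a geometric
  sum. Summing over k leaves only the index N - 1, where r^N = -1.\<close>

lemma herglotz_root_partial_fractions:
  assumes N: "N \<ge> 1" and nz: "\<And>k. k < N \<Longrightarrow> 1 + herglotz_root N k * b \<noteq> 0"
  shows "(1 + b ^ N) * (\<Sum>k<N. herglotz_root N k / (1 + herglotz_root N k * b)) = of_nat N * b ^ (N - 1)"
proof -
  have "(1 + b ^ N) * (herglotz_root N k / (1 + herglotz_root N k * b)) =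
      - (\<Sum>l<N. (- herglotz_root N k) ^ Suc l * b ^ l)" if "k < N" for k
  proof -
    define r where "r = - herglotz_root N k"
    have "1 + b ^ N = 1 - (r * b) ^ N"
      unfolding power_mult_distrib r_def minus_herglotz_root_power[OF N] by simp
    also have "\<dots> = (1 - r * b) * (\<Sum>l<N. (r * b) ^ l)" by (rule one_diff_power_eq)
    finally have "(1 + b ^ N) * (herglotz_root N k / (1 + herglotz_root N k * b)) = - r * (\<Sum>l<N. (r * b) ^ l)"
      using nz[OF that] by (simp add: r_def field_simps)
    thus ?thesis by (simp add: sum_distrib_left r_def[symmetric] power_mult_distrib sum_negf[symmetric] mult_ac)
  qed
  hence "(1 + b ^ N) * (\<Sum>k<N. herglotz_root N k / (1 + herglotz_root N k * b)) =
      - (\<Sum>k<N. \<Sum>l<N. (- herglotz_root N k) ^ Suc l * b ^ l)"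
    by (simp add: sum_distrib_left sum_negf del: power_Suc)
  also have "(\<Sum>k<N. \<Sum>l<N. (- herglotz_root N k) ^ Suc l * b ^ l) =
      (\<Sum>l<N. (\<Sum>k<N. (- herglotz_root N k) ^ Suc l) * b ^ l)"
    unfolding sum_distrib_right by (rule sum.swap)
  also have "\<dots> = (\<Sum>l<N. if l = N - 1 then - of_nat N * b ^ l else 0)"
  proof (intro sum.cong refl)
    fix l assume l: "l \<in> {..<N}"
    show "(\<Sum>k<N. (- herglotz_root N k) ^ Suc l) * b ^ l = (if l = N - 1 then - of_nat N * b ^ l else 0)"
    proof (cases "l = N - 1")
      case True
      hence "Suc l = N" using N by simp
      thus ?thesis using True minus_herglotz_root_power[OF N] by (simp del: power_Suc)
    next
      case False
      thus ?thesis using l sum_minus_herglotz_root_power[of "Suc l" N] by (simp del: power_Suc)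
    qed
  qed
  also have "\<dots> = - of_nat N * b ^ (N - 1)" using N by (subst sum.delta) auto
  finally show ?thesis by simp
qed

lemma one_plus_ray_not_nonpos_Reals:
  fixes c :: complex
  assumes "c \<notin> \<real>\<^sub>\<le>\<^sub>0" "t \<ge> 0"
  shows "1 + of_real t * c \<notin> \<real>\<^sub>\<le>\<^sub>0"
proof (cases "t = 0")
  case False
  thus ?thesis
    using not_nonpos_Reals_add_of_real[OF not_nonpos_Reals_of_real_mult[OF assms(1), of t], of 1] assms
    by (simp add: add.commute)
qed (auto simp: complex_nonpos_Reals_iff)

text \<open>The factorisation alone gives this only up to a multiple of 2 pi i. Replacing b by z b
  and moving z from 0 to 1, both sides have the same derivative and agree at z = 0, while the
  hypotheses keep every argument of \<open>ln\<close> off the cut.\<close>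

lemma sum_ln_herglotz_root:
  assumes N: "N \<ge> 1" and b: "\<And>k. k < N \<Longrightarrow> herglotz_root N k * b \<notin> \<real>\<^sub>\<le>\<^sub>0" "b ^ N \<notin> \<real>\<^sub>\<le>\<^sub>0"
  shows "(\<Sum>k<N. ln (1 + herglotz_root N k * b)) = ln (1 + b ^ N)"
proof -
  define f where "f = (\<lambda>z. (\<Sum>k<N. ln (1 + z * (herglotz_root N k * b))) - ln (1 + z ^ N * b ^ N))"
  have "\<exists>c. \<forall>z\<in>closed_segment 0 1. f z = c"
  proof (rule has_field_derivative_zero_constant)
    fix z assume "z \<in> closed_segment (0::complex) 1"
    then obtain s where s: "z = of_real s" "0 \<le> s" "s \<le> 1" by (rule unit_segmentE)
    have nz: "1 + z * (herglotz_root N k * b) \<notin> \<real>\<^sub>\<le>\<^sub>0" if "k < N" for k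
      unfolding s by (intro one_plus_ray_not_nonpos_Reals b that s)
    hence nz': "1 + herglotz_root N k * (z * b) \<noteq> 0" if "k < N" for k
      using that by (force simp: mult_ac)
    have nzN: "1 + z ^ N * b ^ N \<notin> \<real>\<^sub>\<le>\<^sub>0"
      unfolding s of_real_power[symmetric] by (intro one_plus_ray_not_nonpos_Reals b) (use s in auto)
    hence nzN': "1 + z ^ N * b ^ N \<noteq> 0" by auto
    have "(f has_field_derivative
        (\<Sum>k<N. herglotz_root N k * b / (1 + z * (herglotz_root N k * b)))
         - of_nat N * z ^ (N - 1) * b ^ N / (1 + z ^ N * b ^ N)) (at z within closed_segment 0 1)"
      unfolding f_def using nz nzN
      by (auto intro!: derivative_eq_intros simp: divide_inverse mult_ac)
    also have "(\<Sum>k<N. herglotz_root N k * b / (1 + z * (herglotz_root N k * b)))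
        = b * (\<Sum>k<N. herglotz_root N k / (1 + herglotz_root N k * (z * b)))"
      by (simp add: sum_distrib_left mult_ac)
    also have "(\<Sum>k<N. herglotz_root N k / (1 + herglotz_root N k * (z * b))) = of_nat N * (z * b) ^ (N - 1) / (1 + (z * b) ^ N)"
      using herglotz_root_partial_fractions[OF N, of "z * b"] nz' nzN'
      by (simp add: field_simps power_mult_distrib)
    also have "b * (of_nat N * (z * b) ^ (N - 1) / (1 + (z * b) ^ N)) - of_nat N * z ^ (N - 1) * b ^ N / (1 + z ^ N * b ^ N) = 0"
      using N by (cases N) (auto simp: power_mult_distrib mult_ac)
    finally show "(f has_field_derivative 0) (at z within closed_segment 0 1)" .
  qed auto
  hence "f 1 = f 0" by force
  moreover have "f 0 = 0" using N by (simp add: f_def zero_power)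
  ultimately show ?thesis by (simp add: f_def)
qed

section \<open>Partial sums of the zeta and harmonic series\<close>

text \<open>For K = 1 the powers in \<open>zeta_term\<close> telescope, leaving a multiple of the
  partial zeta sum, and the series converges for Re s > 0. Its value is known for Re s > 1 and is
  carried to the half-plane punctured at 1, which is still connected, by analytic
  continuation.\<close>

lemma zeta_partial_sums_limit:
  assumes s: "Re s > 0" "s \<noteq> 1"
  shows "(\<lambda>M. (\<Sum>m<M. 1 / of_nat (Suc m) powr s) - of_nat (Suc M) powr (1 - s) / (1 - s)) \<longlonglongrightarrow> riemann_zeta s"
proof -
  have zeta: "riemann_zeta holomorphic_on - {1}" "\<And>s. Re s > 1 \<Longrightarrow> riemann_zeta s = dirichlet_zeta s"
    using zeta_continuation_riemann_zeta dirichlet_zeta_sums sums_unique2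
    unfolding zeta_continuation_def by blast+
  have "(\<Sum>n. zeta_term 1 n s) = - 1 - (1 - s) * riemann_zeta s"
  proof (rule analytic_continuation_open[of "{s. Re s > 1}" "{s. Re s > 0} - {1}" "\<lambda>s. \<Sum>n. zeta_term 1 n s"])
    show "connected ({s. Re s > 0} - {1 :: complex})"
      by (intro connected_open_delete convex_connected convex_halfspace_Re_gt open_halfspace_Re_gt) simp
    show "(\<lambda>s. \<Sum>n. zeta_term 1 n s) holomorphic_on {s. Re s > 0} - {1}"
      by (rule holomorphic_on_subset[OF zeta_term_suminf_holomorphic]) auto
    show "(\<lambda>s. - 1 - (1 - s) * riemann_zeta s) holomorphic_on {s. Re s > 0} - {1}"
      by (intro holomorphic_intros holomorphic_on_subset[OF zeta(1)]) auto
    show "{s. Re s > 1} \<noteq> {}" by (auto intro!: exI[of _ 2])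
    fix z :: complex assume "z \<in> {s. Re s > 1}"
    hence z: "Re z > 1" by simp
    show "(\<Sum>n. zeta_term 1 n z) = - 1 - (1 - z) * riemann_zeta z"
      using sums_unique[OF zeta_term_sums[OF z, of 1]] zeta(2)[OF z] by simp
  qed (use s in \<open>auto simp: open_halfspace_Re_gt intro!: open_Diff\<close>)
  moreover have "summable (\<lambda>n. zeta_term 1 n s)"
  proof (rule summable_norm_cancel, rule summable_comparison_test'[where N = 0])
    define C where "C = of_nat (Suc 1) * norm ((1 - s) gchoose Suc 1) * 2 powr norm (1 - s)"
    show "summable (\<lambda>n. C * real (Suc n) powr (- Re s - real 1))"
      using s by (intro summable_mult, subst summable_Suc_iff) (simp add: summable_real_powr_iff)
    show "norm (norm (zeta_term 1 n s)) \<le> C * real (Suc n) powr (- Re s - real 1)" for n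
      using zeta_term_bound[of 1 n s] unfolding C_def by simp
  qed
  ultimately have lim: "(\<lambda>M. \<Sum>n<M. zeta_term 1 n s) \<longlonglongrightarrow> - 1 - (1 - s) * riemann_zeta s"
    by (simp add: summable_sums sums_def[symmetric] sums_iff)
  have part: "(\<Sum>n<M. zeta_term 1 n s) = of_nat (Suc M) powr (1 - s) - 1 - (1 - s) * (\<Sum>m<M. 1 / of_nat (Suc m) powr s)" for M
  proof (induction M)
    case (Suc M)
    have "of_nat (Suc M) powr (- s) = 1 / of_nat (Suc M) powr s"
      by (simp add: powr_minus_divide)
    hence "zeta_term 1 M s = of_nat (Suc (Suc M)) powr (1 - s) - of_nat (Suc M) powr (1 - s) - (1 - s) * (1 / of_nat (Suc M) powr s)"
      by (simp add: zeta_term_def of_nat_Suc[of 0] del: of_nat_Suc)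
    thus ?case unfolding sum.lessThan_Suc Suc.IH by (simp add: distrib_left del: of_nat_Suc)
  qed simp
  have "(\<lambda>M. ((\<Sum>n<M. zeta_term 1 n s) + 1) / (- (1 - s))) \<longlonglongrightarrow> (- 1 - (1 - s) * riemann_zeta s + 1) / (- (1 - s))"
    using s by (intro tendsto_intros lim) auto
  also have "(- 1 - (1 - s) * riemann_zeta s + 1) / (- (1 - s)) = riemann_zeta s"
    using s by (simp add: divide_simps) (simp add: algebra_simps)
  also have "(\<lambda>M. ((\<Sum>n<M. zeta_term 1 n s) + 1) / (- (1 - s))) =
      (\<lambda>M. (\<Sum>m<M. 1 / of_nat (Suc m) powr s) - of_nat (Suc M) powr (1 - s) / (1 - s))"
  proof
    fix M
    define d where "d = 1 - s"
    have "d \<noteq> 0" using s by (simp add: d_def)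
    thus "((\<Sum>n<M. zeta_term 1 n s) + 1) / (- (1 - s)) =
      (\<Sum>m<M. 1 / of_nat (Suc m) powr s) - of_nat (Suc M) powr (1 - s) / (1 - s)"
      unfolding part d_def[symmetric] by (simp add: divide_simps del: of_nat_Suc)
  qed
  finally show ?thesis .
qed

lemma harm_minus_ln_limit: "(\<lambda>M. (\<Sum>m<M. 1 / (2 * of_nat (Suc m))) - of_real (ln (real M)) / 2) \<longlonglongrightarrow> (euler_mascheroni / 2 :: complex)"
proof -
  have "(\<lambda>M. complex_of_real (harm M - ln (real M)) / 2) \<longlonglongrightarrow> of_real euler_mascheroni / 2"
    by (intro tendsto_intros euler_mascheroni_LIMSEQ) auto
  moreover have "complex_of_real (harm M - ln (real M)) / 2 = (\<Sum>m<M. 1 / (2 * of_nat (Suc m))) - of_real (ln (real M)) / 2" for M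
  proof -
    have "harm M = (\<Sum>m<M. 1 / real (Suc m))"
      by (induction M) (auto simp: harm_Suc harm_expand inverse_eq_divide)
    thus ?thesis by (simp add: diff_divide_distrib sum_divide_distrib mult.commute)
  qed
  ultimately show ?thesis by (simp only: of_real_euler_mascheroni)
qed

lemma inverse_twice_nat_null: "(\<lambda>M. 1 / (2 * of_nat M) :: complex) \<longlonglongrightarrow> 0"
  using tendsto_divide[OF lim_1_over_n tendsto_const[of 2]] by (simp add: mult.commute)

section \<open>The reflection formula\<close>

lemma ln_times_Re_pos:
  fixes v w :: complex
  assumes "Re v > 0" "Re w > 0"
  shows "ln (v * w) = ln v + ln w"
proof -
  have "v \<noteq> 0" "w \<noteq> 0" using assms by auto
  moreover from this have "\<bar>Im (ln v)\<bar> < pi / 2" "\<bar>Im (ln w)\<bar> < pi / 2"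
    using assms Re_Ln_pos_lt by blast+
  ultimately show ?thesis by (intro Ln_times_simple) linarith+
qed

lemma Re_of_nat_power_mult: "Re (of_nat n ^ k * z) = real n ^ k * Re z"
proof -
  have "of_nat n ^ k * z = of_real (real n ^ k) * z" by simp
  thus ?thesis by (simp only: times_complex.sel Re_complex_of_real Im_complex_of_real)
qed

locale herglotz_reflection =
  fixes N :: nat and x :: complex
  assumes N: "N \<ge> 1" and x: "Re x > 0"
begin

abbreviation \<omega> :: "nat \<Rightarrow> complex" where "\<omega> \<equiv> herglotz_root N"
abbreviation \<theta> :: "nat \<Rightarrow> real" where "\<theta> \<equiv> herglotz_angle N"

text \<open>The value of the sum of the roots, hence the coefficient of the harmonic terms
  1/n.\<close>

definition \<sigma> :: complex where "\<sigma> = (if N = 1 then 1 else 0)"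

definition y :: complex where "y = x powr (- 1 / of_nat N)"

text \<open>An N-th root of m/x, written as a real multiple of \<open>y\<close> so that for fixed k
  and m > 0 all points \<open>\<omega> k * a m\<close> lie on one ray.\<close>

definition a :: "nat \<Rightarrow> complex" where "a m = of_real (real m powr (1 / real N)) * y"

definition ln_a :: "nat \<Rightarrow> complex" where "ln_a m = (of_real (ln (real m)) - ln x) / of_nat N"

lemma x_nz: "x \<noteq> 0" using x by auto

lemma sum_\<omega>: "(\<Sum>k<N. \<omega> k) = \<sigma>"
  using sum_herglotz_root[OF N] by (simp add: \<sigma>_def)

lemma y_exp: "y = exp (- (ln x / of_nat N))"
  using x_nz by (simp add: y_def powr_def)

lemma y_power: "y ^ N = 1 / x"
proof -
  have "y ^ N = exp (of_nat N * (- (ln x / of_nat N)))" unfolding y_exp by (rule exp_of_nat_mult[symmetric])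
  also have "of_nat N * (- (ln x / of_nat N)) = - ln x" using N by simp
  finally show ?thesis using x_nz by (simp add: exp_minus field_simps)
qed

lemma a_power:
  assumes "m > 0"
  shows "a m ^ N = of_nat m / x"
proof -
  have "(real m powr (1 / real N)) ^ N = real m"
    using assms N by (simp add: powr_realpow[symmetric] powr_powr)
  thus ?thesis by (simp add: a_def power_mult_distrib y_power of_real_power[symmetric] del: of_real_power)
qed

lemma a_nz: "m > 0 \<Longrightarrow> a m \<noteq> 0"
  by (auto simp: a_def y_exp)

lemma \<sigma>_a: "m > 0 \<Longrightarrow> \<sigma> * a m = \<sigma> * (of_nat m / x)"
  using a_power[of m] by (auto simp: \<sigma>_def)

text \<open>The angle \<open>\<theta> k\<close> stays pi/N away from pi and -pi, and dividing the
  argument of x by N makes it smaller than pi/N in modulus. Hence the sum of the exponents lies in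
  the strip of the principal logarithm.\<close>

lemma ln_\<omega>_y:
  assumes "k < N"
  shows "ln (\<omega> k * y) = \<i> * of_real (\<theta> k) - ln x / of_nat N" "\<omega> k * y \<notin> \<real>\<^sub>\<le>\<^sub>0"
proof -
  define u where "u = \<i> * of_real (\<theta> k) - ln x / of_nat N"
  have eq: "\<omega> k * y = exp u"
    by (simp add: herglotz_root_def y_exp u_def exp_diff cis_conv_exp exp_minus divide_inverse)
  have "\<bar>Im (ln x)\<bar> < pi / 2" using x x_nz Re_Ln_pos_lt by blast
  hence 1: "\<bar>Im (ln x) / real N\<bar> < pi / real N"
    using N pi_gt_zero by (simp add: abs_divide divide_strict_right_mono)
  have "\<theta> k \<le> pi * (real N - 1) / real N" "pi * (1 - real N) / real N \<le> \<theta> k"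
    unfolding herglotz_angle_def using assms by (intro divide_right_mono mult_left_mono; simp)+
  hence "\<theta> k \<le> pi - pi / real N" "pi / real N - pi \<le> \<theta> k"
    using N by (simp_all add: diff_divide_distrib right_diff_distrib)
  moreover have "Im u = \<theta> k - Im (ln x) / real N"
    by (simp add: u_def Im_divide_of_nat)
  ultimately have im: "- pi < Im u" "Im u < pi" using 1 by linarith+
  thus ln: "ln (\<omega> k * y) = u" unfolding eq by (intro Ln_exp) auto
  show "\<omega> k * y \<notin> \<real>\<^sub>\<le>\<^sub>0"
  proof
    assume "\<omega> k * y \<in> \<real>\<^sub>\<le>\<^sub>0"
    moreover have "\<omega> k * y \<noteq> 0" unfolding eq by simp
    ultimately have "Im (ln (\<omega> k * y)) = pi"
      by (subst Im_Ln_eq_pi) (auto simp: complex_nonpos_Reals_iff complex_eq_iff)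
    thus False using im ln by simp
  qed
qed

lemma \<omega>_a_eq: "\<omega> k * a m = of_real (real m powr (1 / real N)) * (\<omega> k * y)"
  by (simp add: a_def)

lemma \<omega>_a_not_nonpos: "k < N \<Longrightarrow> m > 0 \<Longrightarrow> \<omega> k * a m \<notin> \<real>\<^sub>\<le>\<^sub>0"
  unfolding \<omega>_a_eq by (intro not_nonpos_Reals_of_real_mult ln_\<omega>_y) auto

lemma ln_\<omega>_a:
  assumes "k < N" "m > 0"
  shows "ln (\<omega> k * a m) = \<i> * of_real (\<theta> k) + ln_a m"
proof -
  have "\<omega> k * y \<noteq> 0" using ln_\<omega>_y(2)[OF assms(1)] by auto
  thus ?thesis unfolding \<omega>_a_eq using assms ln_\<omega>_y(1)[OF assms(1)]
    by (subst Ln_times_of_real) (auto simp: Ln_of_real ln_powr ln_a_def diff_divide_distrib)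
qed

section \<open>Column sums of the double series in closed form\<close>

definition T :: "nat \<Rightarrow> nat \<Rightarrow> complex" where
  "T m n = ln (of_nat m + of_nat (Suc n) ^ N * x) - ln (of_nat (Suc n) ^ N * x) - \<sigma> * (of_nat m / (x * of_nat (Suc n)))"

definition R :: "nat \<Rightarrow> nat \<Rightarrow> complex" where
  "R m n = 1 / (of_nat m + of_nat (Suc n) ^ N * x) - \<sigma> / (x * of_nat (Suc n))"

text \<open>
  \<open>P m\<close> and \<open>Q m\<close> are the sums over \<open>n\<close> of \<open>T m n\<close> and \<open>R m n\<close>. The terms with \<open>\<sigma>\<close>, present
  only for \<open>N = 1\<close>, make these sums converge and cancel in the combination that equals
  \<open>digamma_step\<close>.
\<close>

definition P :: "nat \<Rightarrow> complex" where
  "P m = (if m = 0 then 0 else - (\<Sum>k<N. ln_Gamma (\<omega> k * a m) + euler_mascheroni * (\<omega> k * a m) + ln (\<omega> k * a m)))"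

definition Q :: "nat \<Rightarrow> complex" where
  "Q m = (if m = 0 then if N = 1 then 0 else riemann_zeta (of_nat N) / x
     else - (a m / (of_nat N * of_nat m)) * (\<Sum>k<N. \<omega> k * (Digamma (\<omega> k * a m) + 1 / (\<omega> k * a m) + euler_mascheroni)))"

context
  fixes m n :: nat and b :: complex
  assumes m: "m > 0"
  defines "b \<equiv> a m / of_nat (Suc n)"
begin

lemma \<omega>_b_not_nonpos: "k < N \<Longrightarrow> \<omega> k * b \<notin> \<real>\<^sub>\<le>\<^sub>0"
proof -
  assume k: "k < N"
  have "\<omega> k * b = of_real (1 / real (Suc n)) * (\<omega> k * a m)" by (simp add: b_def del: of_nat_Suc)
  thus ?thesis using not_nonpos_Reals_of_real_mult[OF \<omega>_a_not_nonpos[OF k m], of "1 / real (Suc n)"] by simp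
qed

lemma b_power: "b ^ N = of_nat m / (of_nat (Suc n) ^ N * x)"
  unfolding b_def power_divide a_power[OF m] by (simp del: of_nat_Suc)

text \<open>Inversion preserves the right half-plane, and b^N is a positive multiple of 1/x. Thus 1
  + b^N is nonzero and the logarithm of n^N x (1 + b^N) splits without a branch correction.\<close>

lemma Re_b_power: "Re (b ^ N) > 0"
proof -
  have "b ^ N = of_real (real m / real (Suc n) ^ N) * inverse x"
    unfolding b_power by (simp add: divide_inverse mult_ac del: of_nat_Suc)
  hence "Re (b ^ N) = real m / real (Suc n) ^ N * Re (inverse x)"
    by (simp only: times_complex.sel Re_complex_of_real Im_complex_of_real)
  moreover have "Re (inverse x) > 0" using x by (auto intro!: divide_pos_pos add_pos_nonneg)
  moreover have "real m / real (Suc n) ^ N > 0" using m by simp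
  ultimately show ?thesis by (simp only: mult_pos_pos)
qed

lemma one_plus_b_power: "of_nat m + of_nat (Suc n) ^ N * x = of_nat (Suc n) ^ N * x * (1 + b ^ N)"
  unfolding b_power using x_nz by (simp add: distrib_left del: of_nat_Suc)

text \<open>The right side has the shape of the logarithm of the Weierstrass product for Gamma. Its
  linear convergence terms add up over k to exactly the \<open>\<sigma>\<close> term of
  \<open>T\<close>.\<close>

lemma T_eq: "T m n = - (\<Sum>k<N. \<omega> k * a m / of_nat (Suc n) - ln (1 + \<omega> k * a m / of_nat (Suc n)))"
proof -
  have "Re (of_nat (Suc n) ^ N * x) = real (Suc n) ^ N * Re x"
    by (rule Re_of_nat_power_mult)
  hence "Re (of_nat (Suc n) ^ N * x) > 0" using x by simp
  moreover have "Re (1 + b ^ N) > 0" using Re_b_power by simp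
  ultimately have "ln (of_nat m + of_nat (Suc n) ^ N * x) - ln (of_nat (Suc n) ^ N * x) = ln (1 + b ^ N)"
    unfolding one_plus_b_power by (subst ln_times_Re_pos) auto
  also have "\<dots> = (\<Sum>k<N. ln (1 + \<omega> k * b))"
    using Re_b_power by (intro sum_ln_herglotz_root[symmetric] N \<omega>_b_not_nonpos) (auto simp: complex_nonpos_Reals_iff)
  also have "\<dots> = (\<Sum>k<N. ln (1 + \<omega> k * a m / of_nat (Suc n)))" by (simp add: b_def)
  moreover have "(\<Sum>k<N. \<omega> k * a m / of_nat (Suc n)) = \<sigma> * (of_nat m / (x * of_nat (Suc n)))"
    using \<sigma>_a[OF m] by (simp add: sum_divide_distrib[symmetric] sum_distrib_right[symmetric] sum_\<omega> del: of_nat_Suc)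
  ultimately show ?thesis by (simp add: T_def sum_subtractf)
qed

text \<open>Partial fractions at b give the reciprocal as a sum over the roots. Subtracting 1/(n +
  1) in each summand, as the Digamma series demands, costs the sum of the roots, which is the
  \<open>\<sigma>\<close> term of \<open>R\<close>.\<close>

lemma R_eq: "R m n = a m / (of_nat N * of_nat m) *
    (\<Sum>k<N. \<omega> k * (1 / (of_nat (Suc n) + \<omega> k * a m) - 1 / of_nat (Suc n)))"
proof -
  define W where "W = (\<Sum>k<N. \<omega> k / (of_nat (Suc n) + \<omega> k * a m))"
  have nz: "1 + \<omega> k * b \<noteq> 0" if "k < N" for k
    using one_plus_ray_not_nonpos_Reals[OF \<omega>_b_not_nonpos[OF that], of 1] by auto
  have "(\<Sum>k<N. \<omega> k / (1 + \<omega> k * b)) = of_nat (Suc n) * W"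
    unfolding W_def sum_distrib_left
  proof (intro sum.cong refl)
    fix k assume "k \<in> {..<N}"
    have "of_nat (Suc n) + \<omega> k * a m = of_nat (Suc n) * (1 + \<omega> k * b)"
      by (simp add: b_def distrib_left del: of_nat_Suc)
    thus "\<omega> k / (1 + \<omega> k * b) = of_nat (Suc n) * (\<omega> k / (of_nat (Suc n) + \<omega> k * a m))"
      by (simp del: of_nat_Suc)
  qed
  with herglotz_root_partial_fractions[OF N nz]
  have "(1 + b ^ N) * (of_nat (Suc n) * W) * b = of_nat N * b ^ (N - 1) * b" by simp
  also have "of_nat N * b ^ (N - 1) * b = of_nat N * b ^ N" using N by (cases N) auto
  also have "(1 + b ^ N) * (of_nat (Suc n) * W) * b = (1 + b ^ N) * (W * a m)"
    by (simp add: b_def del: of_nat_Suc)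
  finally have "(1 + b ^ N) * (W * a m) = of_nat N * (of_nat m / (of_nat (Suc n) ^ N * x))"
    by (simp only: b_power)
  hence "(of_nat m + of_nat (Suc n) ^ N * x) * (W * a m) = of_nat N * of_nat m"
    unfolding one_plus_b_power using x_nz by (simp add: field_simps del: of_nat_Suc)
  moreover have "1 + b ^ N \<noteq> 0" using Re_b_power by (metis add_pos_pos less_irrefl one_complex.sel(1) plus_complex.sel(1) zero_complex.sel(1) zero_less_one)
  hence "of_nat m + of_nat (Suc n) ^ N * x \<noteq> 0"
    unfolding one_plus_b_power using x_nz by (simp del: of_nat_Suc)
  ultimately have 1: "1 / (of_nat m + of_nat (Suc n) ^ N * x) = a m / (of_nat N * of_nat m) * W"
    using N m by (simp add: divide_simps mult_ac del: of_nat_Suc)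
  have "a m / (of_nat N * of_nat m) * (\<Sum>k<N. \<omega> k / of_nat (Suc n)) = \<sigma> * a m / (of_nat N * of_nat m) / of_nat (Suc n)"
    by (simp add: sum_divide_distrib[symmetric] sum_\<omega> del: of_nat_Suc)
  also have "\<dots> = \<sigma> / (x * of_nat (Suc n))"
    using \<sigma>_a[OF m] m by (auto simp: \<sigma>_def simp del: of_nat_Suc)
  finally have "R m n = a m / (of_nat N * of_nat m) * (W - (\<Sum>k<N. \<omega> k / of_nat (Suc n)))"
    unfolding R_def 1 by (simp add: right_diff_distrib)
  also have "W - (\<Sum>k<N. \<omega> k / of_nat (Suc n)) = (\<Sum>k<N. \<omega> k * (1 / (of_nat (Suc n) + \<omega> k * a m) - 1 / of_nat (Suc n)))"
    unfolding W_def sum_subtractf[symmetric] by (simp add: right_diff_distrib del: of_nat_Suc)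
  finally show ?thesis .
qed

end

lemma T_sums: "T m sums P m"
proof (cases "m = 0")
  case True
  hence "T m = (\<lambda>n. 0)" by (auto simp: T_def)
  thus ?thesis using True by (simp add: P_def)
next
  case False
  hence m: "m > 0" by simp
  have "\<omega> k * a m \<notin> \<int>\<^sub>\<le>\<^sub>0" if "k < N" for k
    using \<omega>_a_not_nonpos[OF that m] by (metis nonpos_Ints_subset_nonpos_Reals subsetD)
  hence "(\<lambda>n. - (\<Sum>k<N. \<omega> k * a m / of_nat (Suc n) - ln (1 + \<omega> k * a m / of_nat (Suc n)))) sums P m"
    unfolding P_def using False by (auto intro!: sums_minus sums_sum ln_Gamma_series'_aux simp del: of_nat_Suc)
  thus ?thesis using T_eq[OF m] by presburger
qed

lemma R_sums: "R m sums Q m"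
proof (cases "m = 0")
  case True
  show ?thesis
  proof (cases "N = 1")
    case N1: True
    have "R m n = 0" for n unfolding R_def \<sigma>_def using True N1 by (simp add: mult.commute)
    hence "R m = (\<lambda>n. 0)" by blast
    moreover have "Q m = 0" unfolding Q_def using True N1 by simp
    ultimately show ?thesis by simp
  next
    case False
    hence "Re (of_nat N) > (1::real)" using N by simp
    hence "(\<lambda>n. 1 / of_nat (Suc n) powr of_nat N) sums riemann_zeta (of_nat N)"
      using zeta_continuation_riemann_zeta unfolding zeta_continuation_def by blast
    from sums_divide[OF this, of x] show ?thesis
      using True False by (simp add: R_def[abs_def] \<sigma>_def Q_def powr_nat del: of_nat_Suc)
  qed
next
  case False
  hence m: "m > 0" by simp
  have "(\<lambda>n. a m / (of_nat N * of_nat m) * (\<Sum>k<N. \<omega> k * (1 / (of_nat (Suc n) + \<omega> k * a m) - 1 / of_nat (Suc n))))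
    sums (a m / (of_nat N * of_nat m) * (\<Sum>k<N. \<omega> k * (- (Digamma (\<omega> k * a m) + 1 / (\<omega> k * a m) + euler_mascheroni))))"
    using \<omega>_a_not_nonpos m by (intro sums_mult sums_sum Digamma_sums') auto
  also have "(\<Sum>k<N. \<omega> k * (- (Digamma (\<omega> k * a m) + 1 / (\<omega> k * a m) + euler_mascheroni)))
     = - (\<Sum>k<N. \<omega> k * (Digamma (\<omega> k * a m) + 1 / (\<omega> k * a m) + euler_mascheroni))"
    by (simp only: sum_negf[symmetric] mult_minus_right)
  also have "a m / (of_nat N * of_nat m) * - (\<Sum>k<N. \<omega> k * (Digamma (\<omega> k * a m) + 1 / (\<omega> k * a m) + euler_mascheroni)) = Q m"
    using False by (simp add: Q_def)
  finally show ?thesis using R_eq[OF m] by presburger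
qed

text \<open>In the difference of \<open>T\<close> the logarithm of (n + 1)^N x drops out because it
  does not depend on m, and the remaining \<open>\<sigma>\<close> term is cancelled by the mean of
  the two in \<open>R\<close>.\<close>

lemma digamma_step_column_sums:
  "(\<lambda>n. digamma_step (of_nat m + of_nat (Suc n) ^ N * x)) sums (P (Suc m) - P m - (Q m + Q (Suc m)) / 2)"
proof -
  have "digamma_step (of_nat m + of_nat (Suc n) ^ N * x) = T (Suc m) n - T m n - (R m n + R (Suc m) n) / 2" for n
  proof -
    have eq1: "of_nat m + of_nat (Suc n) ^ N * x + 1 = of_nat (Suc m) + of_nat (Suc n) ^ N * x" by simp
    have eq2: "\<sigma> * (of_nat (Suc m) / (x * of_nat (Suc n))) = \<sigma> * (of_nat m / (x * of_nat (Suc n))) + \<sigma> / (x * of_nat (Suc n))"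
      by (simp add: distrib_left add_divide_distrib del: of_nat_Suc add: of_nat_Suc[of m])
    show ?thesis
      unfolding digamma_step_def T_def R_def eq1 eq2 by (simp add: add_divide_distrib diff_divide_distrib del: of_nat_Suc)
  qed
  thus ?thesis by (simp only:) (intro sums_diff sums_divide sums_add T_sums R_sums)
qed

text \<open>Since (n + 1)^N >= n + 1, the real part is at least a constant times c = m + n + 1. From
  c^2 >= (m + 1)(n + 1), the cubic bound in 1/c turns into a product of sequences with the summable
  exponent -3/2, as \<open>suminf_swap_dominated\<close> requires.\<close>

lemma norm_digamma_step_grid_le:
  "norm (digamma_step (of_nat m + of_nat (Suc n) ^ N * x)) \<le>
     1 / (2 * min 1 (Re x) ^ 3) * real (Suc n) powr (- 3 / 2) * real (Suc m) powr (- 3 / 2)"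
proof -
  define r where "r = min 1 (Re x)"
  have r: "0 < r" "r \<le> 1" "r \<le> Re x" using x by (auto simp: r_def)
  define c where "c = real m + real n + 1"
  have c: "c > 0" by (simp add: c_def)
  have Re: "Re (of_nat (Suc n) ^ N * x) = real (Suc n) ^ N * Re x"
    by (rule Re_of_nat_power_mult)
  have "norm (digamma_step (of_nat m + of_nat (Suc n) ^ N * x)) \<le> 1 / (2 * (r * c) ^ 3)"
  proof (rule norm_digamma_step_le)
    show "0 < r * c" using r c by simp
    have "Re (of_nat m + of_nat (Suc n) ^ N * x) > 0" using x Re by (simp add: add_nonneg_pos del: of_nat_Suc)
    thus "of_nat m + of_nat (Suc n) ^ N * x \<notin> \<real>\<^sub>\<le>\<^sub>0" by (auto simp: complex_nonpos_Reals_iff)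
    fix s :: real assume s: "0 \<le> s" "s \<le> 1"
    have "r * c = r * real m + real (Suc n) * r" by (simp add: c_def algebra_simps)
    also have "\<dots> \<le> 1 * real m + real (Suc n) ^ N * Re x"
      using r N by (intro add_mono mult_mono self_le_power) auto
    also have "\<dots> \<le> Re (of_nat m + of_nat (Suc n) ^ N * x + of_real s)" using Re s by (simp del: of_nat_Suc)
    also have "\<dots> \<le> norm (of_nat m + of_nat (Suc n) ^ N * x + of_real s)" by (rule complex_Re_le_cmod)
    finally show "r * c \<le> norm (of_nat m + of_nat (Suc n) ^ N * x + of_real s)" .
  qed
  also have "\<dots> = 1 / (2 * r ^ 3) * (1 / c ^ 3)" by (simp add: power_mult_distrib)
  also have "\<dots> \<le> 1 / (2 * r ^ 3) * (1 / (real (Suc n) * real (Suc m)) powr (3 / 2))"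
  proof (intro mult_left_mono divide_left_mono)
    have "(real (Suc n) * real (Suc m)) powr (3 / 2) \<le> (c ^ 2) powr (3 / 2)"
      by (intro powr_mono2) (auto simp: c_def power2_eq_square algebra_simps)
    also have "\<dots> = (c powr 2) powr (3 / 2)" using c by simp
    also have "\<dots> = c ^ 3" unfolding powr_powr using c by simp
    finally show "(real (Suc n) * real (Suc m)) powr (3 / 2) \<le> c ^ 3" .
  qed (use r c in auto)
  also have "1 / (real (Suc n) * real (Suc m)) powr (3 / 2) = real (Suc n) powr (- 3 / 2) * real (Suc m) powr (- 3 / 2)"
    by (simp add: powr_mult powr_minus_divide)
  finally show ?thesis by (simp add: r_def mult_ac)
qed

text \<open>Rows give the Herglotz summands. Over the columns \<open>P\<close> telescopes from
  \<open>P 0 = 0\<close>, and \<open>Q\<close> is summed with trapezoidal weights, which leaves the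
  half terms at 0 and M.\<close>

lemma limit_eq_ext_herglotz:
  "(\<lambda>M. P M - (\<Sum>m<M. Q (Suc m)) - Q 0 / 2 + Q M / 2) \<longlonglongrightarrow> ext_herglotz 0 (real N) x"
proof -
  define f where "f = (\<lambda>n m. digamma_step (of_nat m + of_nat (Suc n) ^ N * x))"
  define C where "C = 1 / (2 * min 1 (Re x) ^ 3)"
  have C: "C \<ge> 0" using x by (simp add: C_def)
  have s: "summable (\<lambda>n. real (Suc n) powr (- 3 / 2))"
    by (subst summable_Suc_iff) (simp add: summable_real_powr_iff)
  have bound: "norm (f n m) \<le> C * real (Suc n) powr (- 3 / 2) * real (Suc m) powr (- 3 / 2)" for n m
    unfolding f_def C_def by (rule norm_digamma_step_grid_le)
  note swap = suminf_swap_dominated[OF summable_mult[OF s, of C] s, of f, OF bound]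
  have col: "(\<Sum>n. f n m) = P (Suc m) - P m - (Q m + Q (Suc m)) / 2" for m
    using digamma_step_column_sums[of m] by (simp add: f_def sums_iff)
  have row: "(\<Sum>m. f n m) = 1 / of_real (real (Suc n) powr 0) *
       (Digamma (of_real (real (Suc n) powr real N) * x)
        - ln (of_real (real (Suc n) powr real N) * x)
        + 1 / (2 * of_real (real (Suc n) powr real N) * x))" for n
  proof -
    define z where "z = of_nat (Suc n) ^ N * x"
    have "of_real (real (Suc n) powr real N) * x = z"
      by (simp add: z_def powr_realpow del: of_nat_Suc)
    moreover have "Re z = real (Suc n) ^ N * Re x"
      unfolding z_def by (rule Re_of_nat_power_mult)
    hence "Re z > 0" using x by simp
    hence "z \<notin> \<real>\<^sub>\<le>\<^sub>0" by (auto simp: complex_nonpos_Reals_iff)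
    from digamma_step_sums[OF this] have "(\<Sum>m. f n m) = Digamma z - ln z + 1 / (2 * z)"
      by (simp add: f_def z_def[symmetric] sums_iff add.commute del: of_nat_Suc)
    ultimately show ?thesis by (simp add: mult.assoc del: of_nat_Suc)
  qed
  have "ext_herglotz 0 (real N) x = (\<Sum>n. \<Sum>m. f n m)"
    unfolding ext_herglotz_def row ..
  also have "\<dots> = (\<Sum>m. \<Sum>n. f n m)" using C by (intro swap) auto
  finally have "(\<lambda>m. P (Suc m) - P m - (Q m + Q (Suc m)) / 2) sums ext_herglotz 0 (real N) x"
    using swap(2) C by (simp add: col sums_iff)
  moreover have "(\<Sum>m<M. P (Suc m) - P m - (Q m + Q (Suc m)) / 2) =
      P M - (\<Sum>m<M. Q (Suc m)) - Q 0 / 2 + Q M / 2" for M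
  proof (induction M)
    case (Suc M)
    show ?case unfolding sum.lessThan_Suc Suc.IH by (simp add: field_simps)
  qed (simp add: P_def)
  ultimately show ?thesis by (simp add: sums_def)
qed

section \<open>Asymptotics in the cut-off M and the dual Herglotz functions\<close>

definition S :: complex where "S = (\<Sum>k<N. \<omega> k * (\<i> * of_real (\<theta> k)))"

definition \<Phi> :: "nat \<Rightarrow> complex" where
  "\<Phi> m = (\<Sum>k<N. \<omega> k * (Digamma (\<omega> k * a m) - ln (\<omega> k * a m) + 1 / (2 * (\<omega> k * a m))))"

text \<open>Stirling's formula is applied on each of the N rays. In z ln z the angles give
  \<open>S\<close> and the common part \<open>ln_a M\<close> gives the \<open>\<sigma>\<close> term;
  in (ln z)/2 the angles cancel by symmetry and N copies of \<open>ln_a M\<close> make ln M - ln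
  x.\<close>

lemma P_asymp:
  "(\<lambda>M. P M + (a M * (S + \<sigma> * (ln_a M - 1 + euler_mascheroni))
       + (of_real (ln (real M)) - ln x) / 2 + of_nat N * of_real (ln (2 * pi) / 2))) \<longlonglongrightarrow> 0"
proof -
  define E where "E = (\<lambda>k M. let z = of_real (real M powr (1 / real N)) * (\<omega> k * y) in
      ln_Gamma z - (z - 1 / 2) * ln z + z - of_real (ln (2 * pi) / 2))"
  have pos: "1 / real N > 0" using N by simp
  have "filterlim (\<lambda>M. real M powr (1 / real N)) at_top sequentially"
    using pos by real_asymp
  hence "(\<lambda>M. E k M) \<longlonglongrightarrow> 0" if "k < N" for k
    unfolding E_def by (intro ln_Gamma_ray_asymp ln_\<omega>_y that)
  hence "(\<lambda>M. - (\<Sum>k<N. E k M)) \<longlonglongrightarrow> - (\<Sum>k<N. 0)"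
    by (intro tendsto_intros) auto
  hence "(\<lambda>M. - (\<Sum>k<N. E k M)) \<longlonglongrightarrow> 0" by simp
  thus ?thesis
  proof (rule Lim_transform_eventually)
    show "\<forall>\<^sub>F M in sequentially. - (\<Sum>k<N. E k M) = P M + (a M * (S + \<sigma> * (ln_a M - 1 + euler_mascheroni))
       + (of_real (ln (real M)) - ln x) / 2 + of_nat N * of_real (ln (2 * pi) / 2))"
      using eventually_gt_at_top[of 0]
    proof eventually_elim
      case (elim M)
      have "(\<Sum>k<N. E k M) = (\<Sum>k<N. (ln_Gamma (\<omega> k * a M) + euler_mascheroni * (\<omega> k * a M) + ln (\<omega> k * a M))
         - a M * (\<omega> k * (\<i> * of_real (\<theta> k))) - a M * (ln_a M - 1 + euler_mascheroni) * \<omega> k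
         - \<i> / 2 * of_real (\<theta> k) - ln_a M / 2 - of_real (ln (2 * pi) / 2))"
      proof (intro sum.cong refl)
        fix k assume "k \<in> {..<N}"
        hence "ln (\<omega> k * a M) = \<i> * of_real (\<theta> k) + ln_a M" using elim by (intro ln_\<omega>_a) auto
        thus "E k M = ln_Gamma (\<omega> k * a M) + euler_mascheroni * (\<omega> k * a M) + ln (\<omega> k * a M)
         - a M * (\<omega> k * (\<i> * of_real (\<theta> k))) - a M * (ln_a M - 1 + euler_mascheroni) * \<omega> k
         - \<i> / 2 * of_real (\<theta> k) - ln_a M / 2 - of_real (ln (2 * pi) / 2)"
          unfolding E_def Let_def \<omega>_a_eq[symmetric] by (simp add: algebra_simps)
      qed
      also have "\<dots> = - P M - a M * S - a M * (ln_a M - 1 + euler_mascheroni) * \<sigma>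
          - \<i> / 2 * of_real (\<Sum>k<N. \<theta> k) - of_nat N * (ln_a M / 2) - of_nat N * of_real (ln (2 * pi) / 2)"
        using elim unfolding S_def sum_\<omega>[symmetric] of_real_sum P_def
        by (simp only: sum_subtractf sum_distrib_left sum_constant card_lessThan) simp
      also have "of_nat N * (ln_a M / 2) = (of_real (ln (real M)) - ln x) / 2"
        using N by (simp add: ln_a_def)
      finally show ?case
        unfolding sum_herglotz_angle[OF N] by (simp add: algebra_simps)
    qed
  qed
qed

text \<open>Half of the reciprocal of \<open>\<omega> k * a m\<close> completes a Herglotz summand.
  The other half, times \<open>\<omega> k\<close>, is the same for all N roots and yields 1/(2m).
  The logarithm split off from Digamma supplies \<open>S\<close> and the \<open>\<sigma>\<close>
  term.\<close>

lemma Q_eq: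
  assumes "m > 0"
  shows "Q m = - (a m / (of_nat N * of_nat m) * (S + \<sigma> * (ln_a m + euler_mascheroni)))
            - 1 / (2 * of_nat m) - a m / (of_nat N * of_nat m) * \<Phi> m"
proof -
  have "(\<Sum>k<N. \<omega> k * (Digamma (\<omega> k * a m) + 1 / (\<omega> k * a m) + euler_mascheroni)) =
     (\<Sum>k<N. \<omega> k * (Digamma (\<omega> k * a m) - ln (\<omega> k * a m) + 1 / (2 * (\<omega> k * a m))) +
        \<omega> k * (\<i> * of_real (\<theta> k)) + \<omega> k * (ln_a m + euler_mascheroni) + 1 / (2 * a m))"
  proof (intro sum.cong refl)
    fix k assume "k \<in> {..<N}"
    hence ln: "ln (\<omega> k * a m) = \<i> * of_real (\<theta> k) + ln_a m" using assms by (intro ln_\<omega>_a) auto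
    have nz: "\<omega> k \<noteq> 0" "a m \<noteq> 0" using a_nz[OF assms] by (auto simp: herglotz_root_def)
    have "\<omega> k * (1 / (\<omega> k * a m)) = \<omega> k * (1 / (2 * (\<omega> k * a m))) + 1 / (2 * a m)"
      using nz by (simp add: divide_simps)
    thus "\<omega> k * (Digamma (\<omega> k * a m) + 1 / (\<omega> k * a m) + euler_mascheroni) =
       \<omega> k * (Digamma (\<omega> k * a m) - ln (\<omega> k * a m) + 1 / (2 * (\<omega> k * a m))) +
        \<omega> k * (\<i> * of_real (\<theta> k)) + \<omega> k * (ln_a m + euler_mascheroni) + 1 / (2 * a m)"
      unfolding ln by (simp only: distrib_left right_diff_distrib) simp
  qed
  also have "\<dots> = \<Phi> m + S + \<sigma> * (ln_a m + euler_mascheroni) + of_nat N * (1 / (2 * a m))"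
    unfolding \<Phi>_def S_def sum_\<omega>[symmetric] by (simp only: sum.distrib sum_distrib_right sum_constant card_lessThan)
  finally have "Q m = - (a m / (of_nat N * of_nat m)) * (\<Phi> m + S + \<sigma> * (ln_a m + euler_mascheroni) + of_nat N * (1 / (2 * a m)))"
    using assms unfolding Q_def by simp
  also have "\<dots> = - (a m / (of_nat N * of_nat m) * (S + \<sigma> * (ln_a m + euler_mascheroni)))
      - a m / (of_nat N * of_nat m) * (of_nat N * (1 / (2 * a m))) - a m / (of_nat N * of_nat m) * \<Phi> m"
    by (simp add: algebra_simps)
  also have "a m / (of_nat N * of_nat m) * (of_nat N * (1 / (2 * a m))) = 1 / (2 * of_nat m)"
    using a_nz[OF assms] N by simp
  finally show ?thesis .
qed

lemma a_over_eq: "m > 0 \<Longrightarrow> a m / of_nat m = y * of_real (real m powr (1 / real N - 1))"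
  by (simp add: a_def powr_diff)

text \<open>With t = n^(1/N) the remainder along the ray is O(n^(-2/N)), so the weight n^(1/N - 1)
  leaves the exponent -1 - 1/N and the series converges.\<close>

lemma ext_herglotz_dual_sums:
  assumes "k < N"
  shows "(\<lambda>n. y * (of_real (real (Suc n) powr (1 / real N - 1)) *
      (Digamma (\<omega> k * a (Suc n)) - ln (\<omega> k * a (Suc n)) + 1 / (2 * (\<omega> k * a (Suc n))))))
    sums (y * ext_herglotz ((real N - 1) / real N) (1 / real N) (\<omega> k * y))"
proof -
  obtain C where C: "\<And>t :: real. t \<ge> 1 \<Longrightarrow>
    norm (Digamma (of_real t * (\<omega> k * y)) - ln (of_real t * (\<omega> k * y)) + 1 / (2 * (of_real t * (\<omega> k * y)))) \<le> C / t\<^sup>2"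
    using digamma_remainder_ray_bound[OF ln_\<omega>_y(2)[OF assms]] by blast
  define f where "f = (\<lambda>n. of_real (real (Suc n) powr (1 / real N - 1)) *
      (Digamma (\<omega> k * a (Suc n)) - ln (\<omega> k * a (Suc n)) + 1 / (2 * (\<omega> k * a (Suc n)))))"
  have "summable f"
  proof (rule summable_norm_cancel, rule summable_comparison_test'[where N = 0])
    show "summable (\<lambda>n. C * real (Suc n) powr (- 1 - 1 / real N))"
      using N by (intro summable_mult, subst summable_Suc_iff) (simp add: summable_real_powr_iff)
    fix n
    have 1: "real (Suc n) powr (1 / real N) \<ge> 1" by (intro ge_one_powr_ge_zero) auto
    have "norm (f n) \<le> real (Suc n) powr (1 / real N - 1) * (C / (real (Suc n) powr (1 / real N))\<^sup>2)"
      unfolding f_def norm_mult \<omega>_a_eq by (intro mult_mono C 1) auto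
    also have "\<dots> = C * (real (Suc n) powr (1 / real N - 1) / real (Suc n) powr (2 / real N))"
      by (simp add: power2_eq_square powr_add[symmetric] del: of_nat_Suc)
    also have "\<dots> = C * real (Suc n) powr (- 1 - 1 / real N)"
    proof -
      have "1 / real N - 1 - 2 / real N = - 1 - 1 / real N" by (simp add: diff_divide_distrib)
      thus ?thesis by (metis powr_diff)
    qed
    finally show "norm (norm (f n)) \<le> C * real (Suc n) powr (- 1 - 1 / real N)" by simp
  qed
  moreover have "f n = 1 / of_real (real (Suc n) powr ((real N - 1) / real N)) *
       (Digamma (of_real (real (Suc n) powr (1 / real N)) * (\<omega> k * y))
        - ln (of_real (real (Suc n) powr (1 / real N)) * (\<omega> k * y))
        + 1 / (2 * of_real (real (Suc n) powr (1 / real N)) * (\<omega> k * y)))" for n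
  proof -
    have "1 / real N - 1 = - ((real N - 1) / real N)" using N by (simp add: field_simps)
    hence "real (Suc n) powr (1 / real N - 1) = 1 / real (Suc n) powr ((real N - 1) / real N)"
      by (simp add: powr_minus_divide)
    thus ?thesis unfolding f_def \<omega>_a_eq by (simp add: mult.assoc del: of_nat_Suc)
  qed
  ultimately have "f sums ext_herglotz ((real N - 1) / real N) (1 / real N) (\<omega> k * y)"
    unfolding ext_herglotz_def by (metis (no_types, lifting) summable_sums suminf_cong)
  thus ?thesis unfolding f_def by (rule sums_mult)
qed

definition G :: complex where
  "G = y / of_nat N * (\<Sum>k<N. \<omega> k * ext_herglotz ((real N - 1) / real N) (1 / real N) (\<omega> k * y))"

lemma \<Phi>_sums: "(\<lambda>n. a (Suc n) / (of_nat N * of_nat (Suc n)) * \<Phi> (Suc n)) sums G"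
proof -
  have "(\<lambda>n. (\<Sum>k<N. \<omega> k * (y * (of_real (real (Suc n) powr (1 / real N - 1)) *
      (Digamma (\<omega> k * a (Suc n)) - ln (\<omega> k * a (Suc n)) + 1 / (2 * (\<omega> k * a (Suc n))))))) / of_nat N)
    sums ((\<Sum>k<N. \<omega> k * (y * ext_herglotz ((real N - 1) / real N) (1 / real N) (\<omega> k * y))) / of_nat N)"
    by (intro sums_divide sums_sum sums_mult ext_herglotz_dual_sums) auto
  also have "((\<Sum>k<N. \<omega> k * (y * ext_herglotz ((real N - 1) / real N) (1 / real N) (\<omega> k * y))) / of_nat N) = G"
    by (simp add: G_def sum_distrib_left sum_divide_distrib mult_ac)
  also have "(\<lambda>n. (\<Sum>k<N. \<omega> k * (y * (of_real (real (Suc n) powr (1 / real N - 1)) *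
      (Digamma (\<omega> k * a (Suc n)) - ln (\<omega> k * a (Suc n)) + 1 / (2 * (\<omega> k * a (Suc n))))))) / of_nat N)
    = (\<lambda>n. a (Suc n) / (of_nat N * of_nat (Suc n)) * \<Phi> (Suc n))"
  proof
    fix n
    have "a (Suc n) / (of_nat N * of_nat (Suc n)) = y * of_real (real (Suc n) powr (1 / real N - 1)) / of_nat N"
      by (simp add: a_over_eq[symmetric] del: of_nat_Suc)
    thus "(\<Sum>k<N. \<omega> k * (y * (of_real (real (Suc n) powr (1 / real N - 1)) *
      (Digamma (\<omega> k * a (Suc n)) - ln (\<omega> k * a (Suc n)) + 1 / (2 * (\<omega> k * a (Suc n))))))) / of_nat N
      = a (Suc n) / (of_nat N * of_nat (Suc n)) * \<Phi> (Suc n)"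
      unfolding \<Phi>_def by (simp add: sum_distrib_left sum_divide_distrib mult_ac del: of_nat_Suc)
  qed
  finally show ?thesis .
qed

lemma \<Phi>_null: "(\<lambda>M. a M / (of_nat N * of_nat M) * \<Phi> M) \<longlonglongrightarrow> 0"
proof -
  have "(\<lambda>n. a (Suc n) / (of_nat N * of_nat (Suc n)) * \<Phi> (Suc n)) \<longlonglongrightarrow> 0"
    by (rule summable_LIMSEQ_zero[OF sums_summable[OF \<Phi>_sums]])
  thus ?thesis by (rule LIMSEQ_imp_Suc)
qed

text \<open>Now a_M = M y, and the growth M ln M in \<open>P M\<close> is balanced by y ln M!,
  collected from the terms y ln m of \<open>Q\<close>. The end term \<open>Q M / 2\<close> supplies
  the half logarithm that completes \<open>stirling_seq M\<close>, and leaves (y/2)(ln x -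
  gamma).\<close>

lemma reflection_N_eq_1:
  assumes N1: "N = 1"
  shows "ext_herglotz 0 (real N) x = G + (euler_mascheroni + ln x - of_real (ln (2 * pi))) / 2
           + y / 2 * (of_real (ln (2 * pi)) + ln x - euler_mascheroni)"
proof (rule LIMSEQ_unique[OF limit_eq_ext_herglotz])
  have N1': "(of_nat N :: complex) = 1" "1 / real N = 1" by (simp_all add: N1)
  have a: "a m = of_nat m * y" if "m > 0" for m using that by (simp add: a_def N1')
  have S: "S = 0" unfolding S_def by (simp add: N1 herglotz_angle_def)
  have \<sigma>: "\<sigma> = 1" unfolding \<sigma>_def by (simp add: N1)
  have ln_a: "ln_a m = of_real (ln (real m)) - ln x" for m by (simp add: ln_a_def N1')
  have Q0: "Q 0 = 0" unfolding Q_def by (simp add: N1)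
  define B where "B = (\<lambda>M. a M * (S + \<sigma> * (ln_a M - 1 + euler_mascheroni))
       + (of_real (ln (real M)) - ln x) / 2 + of_nat N * complex_of_real (ln (2 * pi) / 2))"
  define D where "D = (\<lambda>m. a m / (of_nat N * of_nat m) * \<Phi> m)"
  have Q: "Q m = - (y * (ln_a m + euler_mascheroni)) - 1 / (2 * of_nat m) - D m" if "m > 0" for m
    unfolding Q_eq[OF that] D_def using that by (simp add: a \<sigma> S N1')
  have fact: "(\<Sum>m<M. of_real (ln (real (Suc m)))) = complex_of_real (ln (fact M))" for M
    by (induction M) (auto simp: ln_mult)
  \<comment> \<open>This is the sequence of \<open>limit_eq_ext_herglotz\<close> for M > 0,
    regrouped so that each part has a known limit.\<close>
  have "(\<lambda>M. (P M + B M) + y * of_real (stirling_seq M) + y / 2 * (ln x - euler_mascheroni)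
      + ((\<Sum>m<M. 1 / (2 * of_nat (Suc m))) - of_real (ln (real M)) / 2)
      + (ln x - of_real (ln (2 * pi))) / 2 + (\<Sum>m<M. D (Suc m)) - 1 / (2 * of_nat M) / 2 - D M / 2)
    \<longlonglongrightarrow> 0 + y * of_real (ln (2 * pi) / 2) + y / 2 * (ln x - euler_mascheroni)
      + euler_mascheroni / 2 + (ln x - of_real (ln (2 * pi))) / 2 + G - 0 / 2 - 0 / 2"
    unfolding B_def D_def
    by (intro tendsto_add tendsto_diff tendsto_mult tendsto_divide tendsto_const tendsto_of_real P_asymp stirling_seq_limit
          harm_minus_ln_limit \<Phi>_sums[unfolded sums_def] inverse_twice_nat_null \<Phi>_null) auto
  also have "0 + y * of_real (ln (2 * pi) / 2) + y / 2 * (ln x - euler_mascheroni)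
      + euler_mascheroni / 2 + (ln x - of_real (ln (2 * pi))) / 2 + G - 0 / 2 - 0 / 2
     = G + (euler_mascheroni + ln x - of_real (ln (2 * pi))) / 2
           + y / 2 * (of_real (ln (2 * pi)) + ln x - euler_mascheroni)"
    by (simp add: field_simps)
  finally show "(\<lambda>M. P M - (\<Sum>m<M. Q (Suc m)) - Q 0 / 2 + Q M / 2) \<longlonglongrightarrow>
      G + (euler_mascheroni + ln x - of_real (ln (2 * pi))) / 2
           + y / 2 * (of_real (ln (2 * pi)) + ln x - euler_mascheroni)"
  proof (rule Lim_transform_eventually)
    show "\<forall>\<^sub>F M in sequentially. (P M + B M) + y * of_real (stirling_seq M) + y / 2 * (ln x - euler_mascheroni)
      + ((\<Sum>m<M. 1 / (2 * of_nat (Suc m))) - of_real (ln (real M)) / 2)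
      + (ln x - of_real (ln (2 * pi))) / 2 + (\<Sum>m<M. D (Suc m)) - 1 / (2 * of_nat M) / 2 - D M / 2
      = P M - (\<Sum>m<M. Q (Suc m)) - Q 0 / 2 + Q M / 2"
      using eventually_gt_at_top[of 0]
    proof eventually_elim
      case (elim M)
      define H where "H = (\<Sum>m<M. 1 / (2 * of_nat (Suc m)) :: complex)"
      define E where "E = (\<Sum>m<M. D (Suc m))"
      define I where "I = 1 / (2 * of_nat M :: complex)"
      have "(\<Sum>m<M. Q (Suc m)) = (\<Sum>m<M. - y * of_real (ln (real (Suc m))) + - y * (euler_mascheroni - ln x)
           - 1 / (2 * of_nat (Suc m)) - D (Suc m))"
        by (intro sum.cong refl) (subst Q, auto simp: ln_a algebra_simps)
      also have "\<dots> = - y * (\<Sum>m<M. of_real (ln (real (Suc m)))) + of_nat M * (- y * (euler_mascheroni - ln x)) - H - E"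
        unfolding H_def E_def
        by (simp only: sum.distrib sum_subtractf sum_distrib_left sum_constant card_lessThan)
      finally have sumQ: "(\<Sum>m<M. Q (Suc m)) = - y * of_real (ln (fact M)) + of_nat M * (- y * (euler_mascheroni - ln x)) - H - E"
        unfolding fact .
      show ?case
        unfolding sumQ Q[OF elim] Q0 B_def \<sigma> S a[OF elim] ln_a stirling_seq_def H_def[symmetric] E_def[symmetric] I_def[symmetric] N1'
        by (simp add: field_simps)
    qed
  qed
qed

text \<open>The growth a_M S of \<open>P M\<close>, of order M^(1/N), cancels against the sum over m
  of m^(1/N - 1), leaving zeta(1 - 1/N) times y S/N. The end term at M tends to 0, while the one at
  0 survives as zeta(N)/(2x).\<close>

lemma reflection_N_ge_2:
  assumes N2: "N \<ge> 2"
  shows "ext_herglotz 0 (real N) x = G + (euler_mascheroni + ln x - of_nat N * of_real (ln (2 * pi))) / 2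
           - of_real pi * y * riemann_zeta (1 - 1 / of_nat N) / (of_nat N * sin (of_real pi / of_nat N))
           - riemann_zeta (of_nat N) / (2 * x)"
proof (rule LIMSEQ_unique[OF limit_eq_ext_herglotz])
  define s where "s = 1 - 1 / (of_nat N :: complex)"
  have S: "S = - of_real pi / sin (of_real pi / of_nat N)"
    unfolding S_def by (rule sum_herglotz_root_angle[OF N2])
  have \<sigma>: "\<sigma> = 0" using N2 by (simp add: \<sigma>_def)
  have Q0: "Q 0 = riemann_zeta (of_nat N) / x" using N2 by (simp add: Q_def)
  define B where "B = (\<lambda>M. a M * (S + \<sigma> * (ln_a M - 1 + euler_mascheroni))
       + (of_real (ln (real M)) - ln x) / 2 + of_nat N * complex_of_real (ln (2 * pi) / 2))"
  define D where "D = (\<lambda>m. a m / (of_nat N * of_nat m) * \<Phi> m)"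
  define e where "e = (\<lambda>m. real m powr (1 / real N - 1))"
  have a_over: "a m / (of_nat N * of_nat m) = y / of_nat N * of_real (e m)" if "m > 0" for m
  proof -
    have "a m / (of_nat N * of_nat m) = a m / of_nat m / of_nat N" by (simp add: mult.commute)
    thus ?thesis unfolding a_over_eq[OF that] by (simp add: e_def)
  qed
  have Q: "Q m = - (y / of_nat N * of_real (e m) * S) - 1 / (2 * of_nat m) - D m" if "m > 0" for m
    unfolding Q_eq[OF that] D_def a_over[OF that] \<sigma> by simp
  have e0: "e \<longlonglongrightarrow> 0"
    unfolding e_def by (rule tendsto_neg_powr[OF _ filterlim_real_sequentially]) (use N2 in auto)
  have e_powr: "1 / of_nat (Suc m) powr s = complex_of_real (e (Suc m))" for m
  proof -
    have "of_nat (Suc m) powr (- s) = complex_of_real (real (Suc m)) powr of_real (1 / real N - 1)"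
      by (simp add: s_def del: of_nat_Suc)
    also have "\<dots> = of_real (e (Suc m))" unfolding e_def by (rule powr_of_real) auto
    finally show ?thesis by (simp add: powr_minus_divide del: of_nat_Suc)
  qed
  have zeta: "(\<lambda>M. (\<Sum>m<M. of_real (e (Suc m))) - of_nat N * of_real (real M powr (1 / real N))) \<longlonglongrightarrow> riemann_zeta s"
  \<comment> \<open>The known limit pairs a sum of M terms with (M + 1)^(1 - s). Adding the null
    term \<open>e (Suc M)\<close> aligns the indices, and the factor N is 1/(1 - s).\<close>
  proof (rule LIMSEQ_imp_Suc)
    have s: "Re s > 0" "s \<noteq> 1"
      using N2 by (auto simp: s_def Re_divide_of_nat)
    have "(\<lambda>M. ((\<Sum>m<M. 1 / of_nat (Suc m) powr s) - of_nat (Suc M) powr (1 - s) / (1 - s)) + of_real (e (Suc M))) \<longlonglongrightarrow> riemann_zeta s + of_real 0"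
      by (intro tendsto_add tendsto_of_real zeta_partial_sums_limit s LIMSEQ_Suc e0)
    also have "(\<lambda>M. ((\<Sum>m<M. 1 / of_nat (Suc m) powr s) - of_nat (Suc M) powr (1 - s) / (1 - s)) + of_real (e (Suc M)))
      = (\<lambda>M. (\<Sum>m<Suc M. of_real (e (Suc m))) - of_nat N * of_real (real (Suc M) powr (1 / real N)))"
    proof
      fix M
      have "of_nat (Suc M) powr (1 - s) = complex_of_real (real (Suc M)) powr of_real (1 / real N)"
        by (simp add: s_def del: of_nat_Suc)
      also have "\<dots> = of_real (real (Suc M) powr (1 / real N))" by (rule powr_of_real) auto
      finally have "of_nat (Suc M) powr (1 - s) / (1 - s) = of_nat N * of_real (real (Suc M) powr (1 / real N))"
        by (simp add: s_def)
      thus "((\<Sum>m<M. 1 / of_nat (Suc m) powr s) - of_nat (Suc M) powr (1 - s) / (1 - s)) + of_real (e (Suc M))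
        = (\<Sum>m<Suc M. of_real (e (Suc m))) - of_nat N * of_real (real (Suc M) powr (1 / real N))"
        unfolding e_powr by simp
    qed
    finally show "(\<lambda>M. (\<Sum>m<Suc M. of_real (e (Suc m))) - of_nat N * of_real (real (Suc M) powr (1 / real N))) \<longlonglongrightarrow> riemann_zeta s"
      by simp
  qed
  have "(\<lambda>M. (P M + B M) + ((\<Sum>m<M. 1 / (2 * of_nat (Suc m))) - of_real (ln (real M)) / 2)
      + (ln x - of_nat N * of_real (ln (2 * pi))) / 2
      + y / of_nat N * S * ((\<Sum>m<M. of_real (e (Suc m))) - of_nat N * of_real (real M powr (1 / real N)))
      + (\<Sum>m<M. D (Suc m)) - riemann_zeta (of_nat N) / x / 2
      + (- (y / of_nat N * of_real (e M) * S) - 1 / (2 * of_nat M) - D M) / 2)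
    \<longlonglongrightarrow> 0 + euler_mascheroni / 2 + (ln x - of_nat N * of_real (ln (2 * pi))) / 2
      + y / of_nat N * S * riemann_zeta s + G - riemann_zeta (of_nat N) / x / 2
      + (- (y / of_nat N * of_real 0 * S) - 0 - 0) / 2"
    unfolding B_def D_def
    by (intro tendsto_add tendsto_diff tendsto_mult tendsto_divide tendsto_minus tendsto_const tendsto_of_real P_asymp
          harm_minus_ln_limit \<Phi>_sums[unfolded sums_def] inverse_twice_nat_null \<Phi>_null zeta e0) auto
  also have "0 + euler_mascheroni / 2 + (ln x - of_nat N * of_real (ln (2 * pi))) / 2
      + y / of_nat N * S * riemann_zeta s + G - riemann_zeta (of_nat N) / x / 2
      + (- (y / of_nat N * of_real 0 * S) - 0 - 0) / 2
     = G + (euler_mascheroni + ln x - of_nat N * of_real (ln (2 * pi))) / 2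
           - of_real pi * y * riemann_zeta (1 - 1 / of_nat N) / (of_nat N * sin (of_real pi / of_nat N))
           - riemann_zeta (of_nat N) / (2 * x)"
    unfolding S s_def by (simp add: add_divide_distrib diff_divide_distrib mult_ac)
  finally show "(\<lambda>M. P M - (\<Sum>m<M. Q (Suc m)) - Q 0 / 2 + Q M / 2) \<longlonglongrightarrow>
      G + (euler_mascheroni + ln x - of_nat N * of_real (ln (2 * pi))) / 2
           - of_real pi * y * riemann_zeta (1 - 1 / of_nat N) / (of_nat N * sin (of_real pi / of_nat N))
           - riemann_zeta (of_nat N) / (2 * x)"
  proof (rule Lim_transform_eventually)
    show "\<forall>\<^sub>F M in sequentially. (P M + B M) + ((\<Sum>m<M. 1 / (2 * of_nat (Suc m))) - of_real (ln (real M)) / 2)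
      + (ln x - of_nat N * of_real (ln (2 * pi))) / 2
      + y / of_nat N * S * ((\<Sum>m<M. of_real (e (Suc m))) - of_nat N * of_real (real M powr (1 / real N)))
      + (\<Sum>m<M. D (Suc m)) - riemann_zeta (of_nat N) / x / 2
      + (- (y / of_nat N * of_real (e M) * S) - 1 / (2 * of_nat M) - D M) / 2
      = P M - (\<Sum>m<M. Q (Suc m)) - Q 0 / 2 + Q M / 2"
      using eventually_gt_at_top[of 0]
    proof eventually_elim
      case (elim M)
      define H where "H = (\<Sum>m<M. 1 / (2 * of_nat (Suc m)) :: complex)"
      define E where "E = (\<Sum>m<M. D (Suc m))"
      define Z where "Z = (\<Sum>m<M. complex_of_real (e (Suc m)))"
      have "(\<Sum>m<M. Q (Suc m)) = (\<Sum>m<M. - (y / of_nat N * S) * of_real (e (Suc m)) - 1 / (2 * of_nat (Suc m)) - D (Suc m))"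
        by (intro sum.cong refl) (subst Q, auto simp: mult_ac)
      also have "\<dots> = - (y / of_nat N * S) * Z - H - E"
        unfolding H_def E_def Z_def by (simp only: sum_subtractf sum_distrib_left)
      finally have sumQ: "(\<Sum>m<M. Q (Suc m)) = - (y / of_nat N * S) * Z - H - E" .
      have "y / of_nat N * S * (Z - of_nat N * of_real (real M powr (1 / real N))) = y / of_nat N * S * Z - a M * S"
        using N by (simp add: a_def right_diff_distrib)
      moreover have "B M = a M * S + of_real (ln (real M)) / 2 - (ln x - of_nat N * of_real (ln (2 * pi))) / 2"
        by (simp add: B_def \<sigma> diff_divide_distrib)
      ultimately show ?case
        unfolding sumQ Q[OF elim] Q0 H_def[symmetric] E_def[symmetric] Z_def[symmetric]
        by (simp add: algebra_simps)
    qed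
  qed
qed

section \<open>Translation into the stated form\<close>

lemma ln_two_pi_power_over_x: "ln ((2 * of_real pi) ^ N / x) = of_nat N * of_real (ln (2 * pi)) - ln x"
proof -
  have "x \<notin> \<real>\<^sub>\<le>\<^sub>0" using x by (auto simp: complex_nonpos_Reals_iff)
  moreover have "(2 * of_real pi) ^ N / x = of_real ((2 * pi) ^ N) * inverse x" by (simp add: divide_inverse)
  hence "ln ((2 * of_real pi) ^ N / x) = ln (of_real ((2 * pi) ^ N)) + ln (inverse x)"
    using x_nz by (simp only:) (intro Ln_times_of_real, auto)
  moreover have "ln (complex_of_real ((2 * pi) ^ N)) = of_real (ln ((2 * pi) ^ N))"
    by (intro Ln_of_real) auto
  moreover have "ln ((2 * pi) ^ N) = real N * ln (2 * pi)" by (rule ln_realpow)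
  ultimately show ?thesis by (simp add: Ln_inverse)
qed

text \<open>The substitution j = N - 1 - 2k turns -pi j/N into \<open>\<theta> k\<close>, and the
  parity condition selects exactly these j.\<close>

lemma G_eq:
  "G = x powr (- 1 / of_nat N) / of_nat N *
      (\<Sum>j \<in> {j :: int. - (int N - 1) \<le> j \<and> j \<le> int N - 1 \<and> j mod 2 = (int N - 1) mod 2}.
         exp (- (\<i> * of_real pi * of_int j / of_nat N)) *
         ext_herglotz ((real N - 1) / real N) (1 / real N)
           (exp (- (\<i> * of_real pi * of_int j / of_nat N)) / x powr (1 / of_nat N)))"
proof -
  have y: "y = inverse (x powr (1 / of_nat N))" by (simp add: y_def powr_minus[symmetric])
  have "bij_betw (\<lambda>k. int N - 1 - 2 * int k) {..<N}
      {j :: int. - (int N - 1) \<le> j \<and> j \<le> int N - 1 \<and> j mod 2 = (int N - 1) mod 2}"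
  proof (rule bij_betwI[where g = "\<lambda>j. nat ((int N - 1 - j) div 2)"])
    show "(\<lambda>k. int N - 1 - 2 * int k) \<in> {..<N} \<rightarrow> {j. - (int N - 1) \<le> j \<and> j \<le> int N - 1 \<and> j mod 2 = (int N - 1) mod 2}"
      by (auto; presburger)
    show "(\<lambda>j. nat ((int N - 1 - j) div 2)) \<in> {j. - (int N - 1) \<le> j \<and> j \<le> int N - 1 \<and> j mod 2 = (int N - 1) mod 2} \<rightarrow> {..<N}"
      using N by auto
  qed (auto, presburger?)
  note reindex = sum.reindex_bij_betw[OF this, symmetric]
  show ?thesis
    unfolding G_def y_def[symmetric] reindex
  proof (intro arg_cong[of _ _ "\<lambda>u. y / of_nat N * u"] sum.cong refl)
    fix k
    have "- (\<i> * of_real pi * of_int (int N - 1 - 2 * int k) / of_nat N) = \<i> * of_real (\<theta> k)"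
      using N by (simp add: herglotz_angle_def field_simps)
    hence "exp (- (\<i> * of_real pi * of_int (int N - 1 - 2 * int k) / of_nat N)) = \<omega> k"
      by (simp only: herglotz_root_def cis_conv_exp)
    thus "\<omega> k * ext_herglotz ((real N - 1) / real N) (1 / real N) (\<omega> k * y) =
      exp (- (\<i> * of_real pi * of_int (int N - 1 - 2 * int k) / of_nat N)) *
         ext_herglotz ((real N - 1) / real N) (1 / real N)
           (exp (- (\<i> * of_real pi * of_int (int N - 1 - 2 * int k) / of_nat N)) / x powr (1 / of_nat N))"
      by (simp only: y divide_inverse)
  qed
qed

end

theorem theorem2p4:
  fixes N :: nat and x :: complex
  assumes "N \<ge> 1" and "Re x > 0"
  shows "ext_herglotz 0 (real N) x =
    x powr (- 1 / of_nat N) / of_nat N *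
      (\<Sum>j \<in> {j :: int. - (int N - 1) \<le> j \<and> j \<le> int N - 1 \<and> j mod 2 = (int N - 1) mod 2}.
         exp (- (\<i> * of_real pi * of_int j / of_nat N)) *
         ext_herglotz ((real N - 1) / real N) (1 / real N)
           (exp (- (\<i> * of_real pi * of_int j / of_nat N)) / x powr (1 / of_nat N)))
    - 1 / 2 * (ln ((2 * of_real pi) ^ N / x) - euler_mascheroni)
    + herglotz_R N x"
proof -
  interpret herglotz_reflection N x by unfold_locales (use assms in auto)
  show ?thesis
  proof (cases "N = 1")
    case True
    have "2 * of_real pi * x = of_real (2 * pi) * x" by simp
    hence "ln (2 * of_real pi * x) = ln (of_real (2 * pi)) + ln x"
      using x_nz by (simp only:) (intro Ln_times_of_real, auto)
    also have "ln (complex_of_real (2 * pi)) = of_real (ln (2 * pi))" by (intro Ln_of_real) auto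
    finally have "ln (2 * of_real pi * x) = of_real (ln (2 * pi)) + ln x" .
    moreover have "y = 1 / x" using y_power True by simp
    ultimately show ?thesis
      unfolding G_eq[symmetric] ln_two_pi_power_over_x reflection_N_eq_1[OF True] herglotz_R_def
      using True by (simp add: diff_divide_distrib add_divide_distrib mult.commute)
  next
    case False
    hence N2: "N \<ge> 2" using assms by simp
    show ?thesis
      unfolding G_eq[symmetric] ln_two_pi_power_over_x reflection_N_ge_2[OF N2] herglotz_R_def y_def
      using False by (simp add: diff_divide_distrib add_divide_distrib)
  qed
qed

end
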